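(* Let $G$ be a finite simple graph. If the girth of $G$ satisfies $g(G)\ge 7$ and the maximum average degree of $G$ satisfies $\operatorname{mad}(G)<\frac{8}{3}$, then $G$ is proper conflict-free $(\mathrm{degree}+2)$-choosable.
   Context: All graphs are finite, simple and undirected. For a vertex $v$ of $G$, $N_G(v)$ is the set of its neighbors and $d_G(v)=|N_G(v)|$. A vertex coloring $\varphi$ is proper if $\varphi(u)\neq\varphi(v)$ for every edge $uv$. A proper conflict-free (PCF) coloring is a proper coloring such that for every non-isolated vertex $v$ some color appears exactly once in $N_G(v)$ (i.e. on exactly one vertex of $N_G(v)$). A list assignment $L$ assigns to each vertex $v$ a set $L(v)$ of colors; an $L$-coloring is a coloring $\varphi$ with $\varphi(v)\in L(v)$ for all $v$. $G$ is proper conflict-free $(\mathrm{degree}+2)$-choosable if for every list assignment $L$ with $|L(v)|\ge d_G(v)+2$ for all $v\in V(G)$ there is a PCF $L$-coloring of $G$. The girth $g(G)$ is the length of a shortest cycle, with $g(G)=\infty$ if $G$ is a forest. The maximum average degree is $\operatorname{mad}(G)=\max_{\varnothing\ne H\subseteq G} 2|E(H)|/|V(H)|$ over all nonempty subgraphs $H$ of $G$, and $\operatorname{mad}(\varnothing)=0$. *)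

theory Defs
  imports Complex_Main "HOL-Library.Extended_Nat"
begin

definition fin_simple_graph :: "'a set \<Rightarrow> 'a set set \<Rightarrow> bool" where
  "fin_simple_graph V E \<longleftrightarrow> finite V \<and> (\<forall>e\<in>E. e \<subseteq> V \<and> card e = 2)"

definition subgraph :: "'a set \<Rightarrow> 'a set set \<Rightarrow> 'a set \<Rightarrow> 'a set set \<Rightarrow> bool" where
  "subgraph V' E' V E \<longleftrightarrow> fin_simple_graph V' E' \<and> V' \<subseteq> V \<and> E' \<subseteq> E"

definition neighborhood :: "'a set set \<Rightarrow> 'a \<Rightarrow> 'a set" where
  "neighborhood E v = {u. {u, v} \<in> E}"

definition degree :: "'a set set \<Rightarrow> 'a \<Rightarrow> nat" where
  "degree E v = card (neighborhood E v)"

text \<open>A cycle is given by its vertices in cyclic order, without repeating the first one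
  at the end, so its length is the length of the list.\<close>

definition is_cycle :: "'a set set \<Rightarrow> 'a list \<Rightarrow> bool" where
  "is_cycle E p \<longleftrightarrow> length p \<ge> 3 \<and> distinct p \<and>
     (\<forall>i. Suc i < length p \<longrightarrow> {p ! i, p ! Suc i} \<in> E) \<and> {last p, hd p} \<in> E"

text \<open>The infimum of the empty set in \<open>enat\<close> is \<open>\<infinity>\<close>, the girth of a forest.\<close>

definition girth :: "'a set set \<Rightarrow> enat" where
  "girth E = Inf {enat (length p) | p. is_cycle E p}"

definition mad :: "'a set \<Rightarrow> 'a set set \<Rightarrow> real" where
  "mad V E = (if V = {} then 0 else
     Max {2 * real (card E') / real (card V') | V' E'. subgraph V' E' V E \<and> V' \<noteq> {}})"

text \<open>The maximum ranges over a finite nonempty set whenever it is used.\<close>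

lemma mad_set_finite_nonempty:
  assumes "fin_simple_graph V E" and "V \<noteq> {}"
  defines "S \<equiv> {2 * real (card E') / real (card V') | V' E'. subgraph V' E' V E \<and> V' \<noteq> {}}"
  shows "finite S" and "S \<noteq> {}"
proof -
  have "finite V" using assms(1) by (simp add: fin_simple_graph_def)
  moreover have "E \<subseteq> Pow V" using assms(1) by (auto simp: fin_simple_graph_def)
  ultimately have "finite (Pow V \<times> Pow E)" by (auto intro: finite_subset)
  moreover have "S \<subseteq> (\<lambda>(V', E'). 2 * real (card E') / real (card V')) ` (Pow V \<times> Pow E)"
    by (auto simp: S_def subgraph_def)
  ultimately show "finite S" by (blast intro: finite_surj)
  have "subgraph V E V E" using assms(1) by (simp add: subgraph_def)
  then show "S \<noteq> {}" using assms(2) by (auto simp: S_def)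
qed

definition proper_coloring :: "'a set set \<Rightarrow> ('a \<Rightarrow> 'c) \<Rightarrow> bool" where
  "proper_coloring E \<phi> \<longleftrightarrow> (\<forall>u v. {u, v} \<in> E \<longrightarrow> \<phi> u \<noteq> \<phi> v)"

definition pcf_coloring :: "'a set \<Rightarrow> 'a set set \<Rightarrow> ('a \<Rightarrow> 'c) \<Rightarrow> bool" where
  "pcf_coloring V E \<phi> \<longleftrightarrow> proper_coloring E \<phi> \<and>
     (\<forall>v\<in>V. neighborhood E v \<noteq> {} \<longrightarrow> (\<exists>c. \<exists>!u. u \<in> neighborhood E v \<and> \<phi> u = c))"

text \<open>The type argument fixes the type from which the colors are drawn. Lists may be
  infinite; since \<open>card\<close> is \<open>0\<close> on infinite sets, this case is listed separately.\<close>

definition pcf_degree_plus_choosable ::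
    "'c itself \<Rightarrow> nat \<Rightarrow> 'a set \<Rightarrow> 'a set set \<Rightarrow> bool" where
  "pcf_degree_plus_choosable _ k V E \<longleftrightarrow>
     (\<forall>L :: 'a \<Rightarrow> 'c set.
        (\<forall>v\<in>V. infinite (L v) \<or> card (L v) \<ge> degree E v + k) \<longrightarrow>
        (\<exists>\<phi>. pcf_coloring V E \<phi> \<and> (\<forall>v\<in>V. \<phi> v \<in> L v)))"

end

theory Submission
  imports Defs
begin

text \<open>Take a counterexample with the fewest vertices. Pick a center \<open>w\<close>, delete it together with parts of
  the branches hanging at its neighbors, color the rest by minimality, and extend. Deleted vertices
  have degree 2 or 3, so once \<open>w\<close> has a color \<open>\<gamma>\<close> every branch can be completed, and for all but a few
  \<open>\<gamma>\<close> (at most two per branch) it leaves at least two colors for its neighbor of \<open>w\<close>. As \<open>w\<close> has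
  \<open>d + 2\<close> colors, counting yields a \<open>\<gamma>\<close> for which at most three branches are rigid, and then some
  color can be made unique around \<open>w\<close>. Girth 7 keeps the branches apart. The configurations excluded
  in this way bound what a vertex of degree at least 4 has to send to its surroundings for all
  vertices to end up with average degree \<open>8/3\<close>, which contradicts the bound on the maximum average degree.\<close>

section \<open>Selecting colors with a unique one\<close>

text \<open>The charge of a vertex of degree \<open>d\<close> is \<open>d - 8/3\<close>, counted in
  ninths: \<open>9 * d - 24\<close>, hence -6 at degree 2 and 3 at degree 3. The weights repair the
  deficits. A vertex of degree 2 gets 3 from each side, or all 6 from its end of a thread; the
  middle of three consecutive ones gets 3 through each neighbor, which makes 9 = 6 + 3. A vertex of
  degree 3 pays 3 to each neighbor of degree 2; with two of them it needs 3 more, with three of them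
  6 more, brought by 2 along each arm, whence 5 = 3 + 2. The larger the deleted part of a branch,
  the fewer colors it forbids at the center or the fewer colors make it rigid, so the count pushes
  towards deep deletions. Depth is the obstacle. Walks of four edges in different branches may meet,
  as girth 7 allows cycles of length 7 and 8; an outer vertex then has several uncolored neighbors
  and could be left without a colored one. Hence outer vertices at that depth must have degree at
  least 4, and at most two branches may be deep.\<close>

definition uniq :: "('a \<Rightarrow> 'c) \<Rightarrow> 'a set \<Rightarrow> bool" where
  "uniq \<psi> X \<longleftrightarrow> (\<exists>a\<in>X. \<forall>b\<in>X. \<psi> b = \<psi> a \<longrightarrow> b = a)"

lemma uniq_iff: "uniq \<psi> X \<longleftrightarrow> (\<exists>c. \<exists>!u. u \<in> X \<and> \<psi> u = c)"
  unfolding uniq_def by metis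

lemma uniq_cong: "uniq \<psi> X \<Longrightarrow> (\<And>x. x \<in> X \<Longrightarrow> \<psi>' x = \<psi> x) \<Longrightarrow> uniq \<psi>' X"
  unfolding uniq_def by metis

lemma uniq_insert2: "\<psi> a \<noteq> \<psi> b \<Longrightarrow> uniq \<psi> {a, b}"
  unfolding uniq_def by auto

text \<open>Three colors that are not all equal contain one that differs from the two others; so a
  vertex of degree 3 only needs two differently colored neighbors.\<close>

lemma uniq_insert3:
  assumes "\<not> (\<psi> a = \<psi> b \<and> \<psi> a = \<psi> c)"
  shows "uniq \<psi> {a, b, c}"
proof -
  consider "\<psi> a \<noteq> \<psi> b" "\<psi> a \<noteq> \<psi> c" | "\<psi> b \<noteq> \<psi> a" "\<psi> b \<noteq> \<psi> c" | "\<psi> c \<noteq> \<psi> a" "\<psi> c \<noteq> \<psi> b"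
    using assms by metis
  then show ?thesis unfolding uniq_def by cases auto
qed

lemma card_ge_2_iff: "2 \<le> card A \<longleftrightarrow> finite A \<and> (\<exists>x\<in>A. \<exists>y\<in>A. x \<noteq> y)"
proof
  assume h: "2 \<le> card A"
  then have f: "finite A" by (metis card.infinite not_numeral_le_zero)
  with h show "finite A \<and> (\<exists>x\<in>A. \<exists>y\<in>A. x \<noteq> y)"
    by (metis One_nat_def Suc_1 card_le_Suc0_iff_eq not_less_eq_eq)
next
  assume h: "finite A \<and> (\<exists>x\<in>A. \<exists>y\<in>A. x \<noteq> y)"
  then show "2 \<le> card A" by (metis One_nat_def Suc_1 card_le_Suc0_iff_eq not_less_eq_eq)
qed

text \<open>A color occurring on one nonflexible vertex only, or on none of them, can be kept off all
  but one vertex; three nonflexible vertices cannot carry two colors at least twice each.\<close>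

lemma unique_selection:
  assumes ne: "\<And>i. i \<in> I \<Longrightarrow> P i \<noteq> {}"
    and fin: "finite J" and JI: "J \<subseteq> I" and J3: "card J \<le> 3"
    and flex: "\<And>i. i \<in> I - J \<Longrightarrow> \<exists>p\<in>P i. \<exists>q\<in>P i. p \<noteq> q"
    and ex: "I - J \<noteq> {}"
  shows "\<exists>p. (\<forall>i\<in>I. p i \<in> P i) \<and> uniq p I"
proof -
  define q where "q i = (SOME c. c \<in> P i)" for i
  have q: "q i \<in> P i" if "i \<in> I" for i
    using ne[OF that] unfolding q_def by (simp add: some_in_eq)
  define r where "r a i = (SOME c. c \<in> P i \<and> c \<noteq> a)" for a i
  have r: "r a i \<in> P i \<and> r a i \<noteq> a" if "i \<in> I - J" for a i
    using flex[OF that] unfolding r_def by (metis (mono_tags, lifting) someI_ex)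
  obtain i0 where i0: "i0 \<in> I" "i0 \<notin> J" using ex by auto
  obtain a b where ab: "a \<in> P i0" "b \<in> P i0" "a \<noteq> b" using flex i0 by blast
  have free: ?thesis if "c \<in> P i0" "\<forall>j\<in>J. q j \<noteq> c" for c
  proof -
    let ?p = "\<lambda>i. if i = i0 then c else if i \<in> J then q i else r c i"
    have "\<forall>i\<in>I. ?p i \<in> P i" using q r that i0 by auto
    moreover have "\<forall>j\<in>I. ?p j = ?p i0 \<longrightarrow> j = i0" using r that i0 by auto
    ultimately show ?thesis unfolding uniq_def using i0 by (intro exI[of _ ?p]) blast
  qed
  have once: ?thesis if "j0 \<in> J" "\<forall>j\<in>J. q j = q j0 \<longrightarrow> j = j0" for j0
  proof -
    let ?p = "\<lambda>i. if i \<in> J then q i else r (q j0) i"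
    have "\<forall>i\<in>I. ?p i \<in> P i" using q r by auto
    moreover have "\<forall>j\<in>I. ?p j = ?p j0 \<longrightarrow> j = j0" using r that by auto
    ultimately show ?thesis unfolding uniq_def using that(1) JI by (intro exI[of _ ?p]) blast
  qed
  show ?thesis
  proof (rule ccontr)
    assume no: "\<not> ?thesis"
    have two: "card {j \<in> J. q j = c} \<ge> 2" if c: "c \<in> P i0" for c
    proof -
      obtain j where "j \<in> J" "q j = c" using free[OF c] no by blast
      then obtain j' where "j' \<in> J" "q j' = c" "j' \<noteq> j" using once[of j] no by metis
      then show ?thesis unfolding card_ge_2_iff using fin \<open>j \<in> J\<close> \<open>q j = c\<close> by auto
    qed
    have "card ({j \<in> J. q j = a} \<union> {j \<in> J. q j = b}) = card {j \<in> J. q j = a} + card {j \<in> J. q j = b}"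
      using ab(3) fin by (intro card_Un_disjoint) auto
    moreover have "card ({j \<in> J. q j = a} \<union> {j \<in> J. q j = b}) \<le> card J"
      using fin by (intro card_mono) auto
    ultimately show False using two[OF ab(1)] two[OF ab(2)] J3 by linarith
  qed
qed

text \<open>Double counting of the pairs of an index \<open>i\<close> and a color in
  \<open>X \<inter> B i\<close>: on average a color of \<open>X\<close> lies in fewer than
  \<open>m\<close> of the sets.\<close>

lemma pigeonhole_color:
  fixes b :: "'a \<Rightarrow> nat"
  assumes finI: "finite I" and fB: "\<And>i. i \<in> I \<Longrightarrow> card (B i) \<le> b i \<and> finite (B i)"
    and lt: "sum b I < m * card X"
  shows "\<exists>x\<in>X. card {i \<in> I. x \<in> B i} < m"
proof (rule ccontr)
  assume "\<not> ?thesis"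
  then have ge: "m \<le> card {i \<in> I. x \<in> B i}" if "x \<in> X" for x using that by auto
  have finX: "finite X" using lt by (metis card.infinite mult_0_right not_less0)
  have "m * card X = (\<Sum>x\<in>X. m)" by simp
  also have "\<dots> \<le> (\<Sum>x\<in>X. card {i \<in> I. x \<in> B i})" using ge by (intro sum_mono)
  also have "\<dots> = (\<Sum>x\<in>X. \<Sum>i\<in>I. if x \<in> B i then 1 else 0)"
    using finI by (simp add: sum.If_cases Int_def conj_commute)
  also have "\<dots> = (\<Sum>i\<in>I. \<Sum>x\<in>X. if x \<in> B i then 1 else 0)" by (rule sum.swap)
  also have "\<dots> = (\<Sum>i\<in>I. card (X \<inter> B i))" using finX by (simp add: sum.If_cases Int_def)
  also have "\<dots> \<le> sum b I"
    using fB by (intro sum_mono) (meson Int_lower2 card_mono le_trans)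
  finally show False using lt by linarith
qed

lemma card_Diff_UN_ge:
  assumes "finite I" and "\<And>i. i \<in> I \<Longrightarrow> finite (F i) \<and> card (F i) \<le> f i" and "finite X"
  shows "card X \<le> card (X - (\<Union>i\<in>I. F i)) + sum f I"
proof -
  have "card (\<Union>i\<in>I. F i) \<le> (\<Sum>i\<in>I. card (F i))" using assms(1) by (rule card_UN_le)
  also have "\<dots> \<le> sum f I" using assms(2) by (intro sum_mono) auto
  finally have "card (\<Union>i\<in>I. F i) \<le> sum f I" .
  moreover have "card X - card (\<Union>i\<in>I. F i) \<le> card (X - (\<Union>i\<in>I. F i))"
    using assms by (intro diff_card_le_card_Diff) auto
  ultimately show ?thesis by linarith
qed

text \<open>The selection lemma for the colors \<open>\<gamma>\<close> of a center: \<open>I\<close> are the branches, \<open>F i\<close>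
  the colors that branch \<open>i\<close> forbids at the center, \<open>B i\<close> the colors \<open>\<gamma>\<close> for which branch \<open>i\<close>
  is not flexible, and the branches in \<open>T\<close> are never flexible.\<close>

lemma center_choice:
  fixes P :: "'a \<Rightarrow> 'c \<Rightarrow> 'c set"
  assumes finI: "finite I" and finX: "finite X" and TI: "T \<subseteq> I"
    and X: "card I + 2 \<le> card X"
    and F: "\<And>i. i \<in> I \<Longrightarrow> finite (F i) \<and> card (F i) \<le> f i"
    and B: "\<And>i. i \<in> I - T \<Longrightarrow> finite (B i) \<and> card (B i) \<le> b i"
    and ne: "\<And>i \<gamma>. i \<in> I \<Longrightarrow> \<gamma> \<notin> F i \<Longrightarrow> P i \<gamma> \<noteq> {}"
    and flex: "\<And>i \<gamma>. i \<in> I - T \<Longrightarrow> \<gamma> \<notin> F i \<Longrightarrow> \<gamma> \<notin> B i \<Longrightarrow> \<exists>p\<in>P i \<gamma>. \<exists>q\<in>P i \<gamma>. p \<noteq> q"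
    and m: "m + card T \<le> 4" "m + card T \<le> card I"
    and ineq: "int (sum b (I - T)) < int m * (int (card I) + 2 - int (sum f I))"
  shows "\<exists>\<gamma>\<in>X. \<exists>p. (\<forall>i\<in>I. \<gamma> \<notin> F i \<and> p i \<in> P i \<gamma>) \<and> uniq p I"
proof -
  define Y where "Y = X - (\<Union>i\<in>I. F i)"
  have "card X \<le> card Y + sum f I" unfolding Y_def using finI F finX by (intro card_Diff_UN_ge) auto
  then have "int (card I) + 2 - int (sum f I) \<le> int (card Y)" using X by linarith
  then have "int m * (int (card I) + 2 - int (sum f I)) \<le> int m * int (card Y)"
    by (intro mult_left_mono) auto
  then have "int (sum b (I - T)) < int (m * card Y)" using ineq by simp
  then have "sum b (I - T) < m * card Y" by linarith
  then obtain \<gamma> where g: "\<gamma> \<in> Y" "card {i \<in> I - T. \<gamma> \<in> B i} < m"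
    using pigeonhole_color[of "I - T" B b m Y] finI B by auto
  \<comment> \<open>The rigid branches for this color. There are fewer than
    \<open>m + card T\<close>, so the two bounds on \<open>m\<close> give at most three of them and
    at least one flexible branch.\<close>
  define J where "J = T \<union> {i \<in> I - T. \<gamma> \<in> B i}"
  have "card J \<le> card T + card {i \<in> I - T. \<gamma> \<in> B i}" unfolding J_def by (rule card_Un_le)
  then have J: "card J \<le> 3" "card J < card I" using g(2) m by linarith+
  have JI: "J \<subseteq> I" using TI unfolding J_def by auto
  have gF: "\<gamma> \<notin> F i" if "i \<in> I" for i using g(1) that unfolding Y_def by auto
  obtain p where p: "\<forall>i\<in>I. p i \<in> P i \<gamma>" "uniq p I"
  proof (rule exE[OF unique_selection[where J = J and P = "\<lambda>i. P i \<gamma>"]])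
    show "I - J \<noteq> {}" using J(2) JI by (metis Diff_eq_empty_iff less_irrefl subset_antisym)
    show "finite J" using JI finI finite_subset by blast
  qed (use JI J ne gF flex in \<open>auto simp: J_def\<close>)
  have "\<gamma> \<in> X" using g(1) unfolding Y_def by simp
  moreover have "\<forall>i\<in>I. \<gamma> \<notin> F i \<and> p i \<in> P i \<gamma>" using gF p(1) by simp
  ultimately show ?thesis using p(2) by (intro bexI[of _ \<gamma>] exI[of _ p] conjI)
qed

lemma ex_remaining:
  assumes "finite F" and "card F < card X"
  shows "\<exists>x\<in>X. x \<notin> F"
  using assms by (metis card_mono not_le subsetI)

lemma ex_two_remaining:
  assumes "finite F" and "card F + 2 \<le> card X"
  shows "\<exists>x\<in>X. \<exists>y\<in>X. x \<notin> F \<and> y \<notin> F \<and> x \<noteq> y"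
proof -
  have "2 \<le> card (X - F)" using diff_card_le_card_Diff[OF assms(1), of X] assms(2) by linarith
  then show ?thesis unfolding card_ge_2_iff by blast
qed

lemma card_insert_le2: "card {a, b} \<le> 2" "card {a, b, c} \<le> 3"
  by (simp_all add: card_insert_if)

text \<open>Losing one color matters only to a set of exactly two colors, and then the harmful
  colors are its own two.\<close>

lemma bad_colors:
  assumes "2 \<le> card A"
  shows "\<exists>B. finite B \<and> card B \<le> 2 \<and> (\<forall>\<gamma>. \<gamma> \<notin> B \<longrightarrow> 2 \<le> card (A - {\<gamma>}))"
proof (cases "card A = 2")
  case True
  then have "finite A" using card.infinite by fastforce
  then show ?thesis using True by (intro exI[of _ A]) auto
next
  case False
  then have f: "finite A" "3 \<le> card A" using assms by (auto intro: card_ge_0_finite)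
  then show ?thesis by (intro exI[of _ "{}"]) (auto simp: card_Diff_singleton_if)
qed

section \<open>Branches in graphs of girth at least 7\<close>

lemma neighborhood_sym: "u \<in> neighborhood E v \<longleftrightarrow> v \<in> neighborhood E u"
  unfolding neighborhood_def by (simp add: insert_commute)

lemma finite_neighborhood: "fin_simple_graph V E \<Longrightarrow> finite (neighborhood E v)"
  unfolding fin_simple_graph_def neighborhood_def
  by (rule finite_subset[of _ V]) auto

lemma neighborhood_subset: "fin_simple_graph V E \<Longrightarrow> neighborhood E v \<subseteq> V"
  unfolding fin_simple_graph_def neighborhood_def by auto

lemma neighborhood_irrefl: "fin_simple_graph V E \<Longrightarrow> v \<notin> neighborhood E v"
  unfolding fin_simple_graph_def neighborhood_def by auto

text \<open>Walks that never turn back along the edge just used.\<close>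

fun nb_walk :: "'a set set \<Rightarrow> 'a list \<Rightarrow> bool" where
  "nb_walk E (x # y # z # p) \<longleftrightarrow> {x, y} \<in> E \<and> x \<noteq> z \<and> nb_walk E (y # z # p)"
| "nb_walk E [x, y] \<longleftrightarrow> {x, y} \<in> E"
| "nb_walk E _ \<longleftrightarrow> True"

lemma nb_walk_Cons: "nb_walk E (x # p) \<Longrightarrow> nb_walk E p"
  by (cases "(E, x # p)" rule: nb_walk.cases) auto

lemma nb_walk_Cons_Cons: "nb_walk E (x # y # p) \<Longrightarrow> {x, y} \<in> E"
  by (cases p) auto

lemma nb_walk_append: "nb_walk E (p @ q) \<Longrightarrow> nb_walk E p"
proof (induction E p rule: nb_walk.induct)
  case (2 E x y)
  then show ?case using nb_walk_Cons_Cons by fastforce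
qed simp_all

lemma nb_walk_nth: "nb_walk E p \<Longrightarrow> Suc i < length p \<Longrightarrow> {p ! i, p ! Suc i} \<in> E"
proof (induction p arbitrary: i)
  case (Cons x p)
  show ?case
  proof (cases i)
    case 0
    then show ?thesis using Cons.prems by (cases p) (auto dest: nb_walk_Cons_Cons)
  next
    case (Suc j)
    then show ?thesis using Cons.IH[of j] Cons.prems nb_walk_Cons by fastforce
  qed
qed simp

text \<open>The two walks overlap in the whole edge between \<open>u\<close> and \<open>w\<close>,
  not just in a vertex; this is why the joined walk does not turn back at the seam.\<close>

lemma nb_walk_rev_append:
  "nb_walk E (w # u # p) \<Longrightarrow> nb_walk E (u # w # q) \<Longrightarrow> nb_walk E (rev p @ u # w # q)"
proof (induction p arbitrary: u w q)
  case (Cons a p)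
  have "nb_walk E (a # u # w # q)" using Cons.prems by (cases p) (auto simp: insert_commute)
  moreover have "nb_walk E (u # a # p)" using nb_walk_Cons[OF Cons.prems(1)] .
  ultimately show ?case using Cons.IH[of u a "w # q"] by simp
qed simp

locale girth_7_graph =
  fixes V :: "'a set" and E :: "'a set set"
  assumes graph: "fin_simple_graph V E"
    and cycle_length: "is_cycle E p \<Longrightarrow> 7 \<le> length p"
begin

abbreviation "N \<equiv> neighborhood E"

lemmas finite_N [simp] = finite_neighborhood[OF graph]
  and N_subset = neighborhood_subset[OF graph]
  and N_irrefl = neighborhood_irrefl[OF graph]

lemma N_sym: "x \<in> N y \<Longrightarrow> y \<in> N x"
  by (simp add: neighborhood_sym)

lemma edge_iff: "{x, y} \<in> E \<longleftrightarrow> x \<in> N y"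
  by (simp add: neighborhood_def)

lemma N_eq_D: "N x = insert y Y \<Longrightarrow> {x, y} \<in> E"
  by (metis edge_iff insertI1 insert_commute)

text \<open>A first return to the head closes a cycle: its vertices are distinct by induction, and
  in a list of at most 7 entries its length is at most 6.\<close>

lemma nb_walk_distinct: "nb_walk E p \<Longrightarrow> length p \<le> 7 \<Longrightarrow> distinct p"
proof (induction p)
  case (Cons x p)
  have p: "distinct p" using Cons nb_walk_Cons[OF Cons.prems(1)] by simp
  have "x \<notin> set p"
  proof
    assume "x \<in> set p"
    then obtain q r where pq: "p = q @ x # r" "x \<notin> set q" by (meson split_list_first)
    have w: "nb_walk E ((x # q) @ x # r)" using Cons.prems pq by simp
    then have w': "nb_walk E ((x # q) @ [x])"
      using nb_walk_append[of E "(x # q) @ [x]" r] by simp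
    \<comment> \<open>A return after one step would be a loop, after two steps the walk would turn
      back.\<close>
    have len: "3 \<le> length (x # q)"
    proof (rule ccontr)
      assume "\<not> ?thesis"
      then consider "q = []" | a where "q = [a]" by (cases q; cases "tl q") auto
      then show False using w' N_irrefl[of x] edge_iff[of x x] by cases auto
    qed
    have "is_cycle E (x # q)"
      unfolding is_cycle_def
    proof (intro conjI allI impI)
      show "distinct (x # q)" using p pq by simp
      show "{(x # q) ! i, (x # q) ! Suc i} \<in> E" if "Suc i < length (x # q)" for i
        using nb_walk_nth[OF nb_walk_append[OF w] that] .
      have "Suc (length q) < length ((x # q) @ [x])" by simp
      from nb_walk_nth[OF w' this] show "{last (x # q), hd (x # q)} \<in> E"
        by (auto simp: last_conv_nth nth_append)
    qed (use len in auto)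
    then show False using cycle_length Cons.prems(2) pq by fastforce
  qed
  then show ?case using p by simp
qed simp

text \<open>The reversed first walk followed by the second has
  \<open>length p + length p' + 3\<close> vertices, the 3 being \<open>u\<close>, \<open>w\<close>
  and \<open>u'\<close>. These are at most 7, so its two ends differ.\<close>

lemma nb_walks_meet:
  assumes "nb_walk E (w # u # p)" "nb_walk E (w # u' # p')" "u \<noteq> u'"
    and "last (u # p) = last (u' # p')" "length p + length p' \<le> 4"
  shows False
proof -
  have "nb_walk E (u # w # u' # p')"
    using assms(1-3) nb_walk_Cons_Cons[OF assms(1)] by (simp add: insert_commute)
  then have "nb_walk E (rev p @ u # w # u' # p')" by (rule nb_walk_rev_append[OF assms(1)])
  then have d: "distinct (rev (u # p) @ w # u' # p')" 
    using assms(5) by (intro nb_walk_distinct) simp_all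
  have "last (u # p) \<in> set (rev (u # p))" by (metis last_in_set list.discI set_rev)
  moreover have "last (u' # p') \<in> set (w # u' # p')" by (metis last_ConsR last_in_set list.discI)
  ultimately show False using d assms(4) by (metis disjoint_iff distinct_append)
qed

text \<open>The deleted part \<open>D\<close> of the branch at the neighbor \<open>u\<close> of the center \<open>w\<close>: it lies within
  distance 3 of \<open>w\<close>, and only deep branches contain vertices at distance 3 that have neighbors
  farther away.\<close>

definition shape :: "'a \<Rightarrow> 'a \<Rightarrow> 'a set \<Rightarrow> bool \<Rightarrow> bool" where
  "shape w u D deep \<longleftrightarrow>
     u \<in> N w \<and> D \<subseteq> V \<and> (D \<noteq> {} \<longrightarrow> u \<in> D) \<and>
     (\<forall>a\<in>D. card (N a) \<le> 3 \<and>
        (\<exists>p. nb_walk E (w # u # p) \<and> last (u # p) = a \<and> length p \<le> 2) \<and>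
        (\<forall>y\<in>N a - D - {w}. \<exists>p. nb_walk E (w # u # p @ [y]) \<and>
           (length p \<le> 1 \<or> length p = 2 \<and> deep \<and> 4 \<le> card (N y)))) \<and>
     (\<forall>y. y \<notin> D \<longrightarrow> y \<noteq> w \<longrightarrow> (\<forall>a\<in>N y \<inter> D. \<forall>a'\<in>N y \<inter> D. a = a'))"

lemma shapeD:
  assumes "shape w u D deep"
  shows "u \<in> N w" "D \<noteq> {} \<Longrightarrow> u \<in> D" "a \<in> D \<Longrightarrow> card (N a) \<le> 3"
    and "a \<in> D \<Longrightarrow> \<exists>p. nb_walk E (w # u # p) \<and> last (u # p) = a \<and> length p \<le> 2"
    and "a \<in> D \<Longrightarrow> y \<in> N a \<Longrightarrow> y \<notin> D \<Longrightarrow> y \<noteq> w \<Longrightarrow>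
          \<exists>p. nb_walk E (w # u # p @ [y]) \<and>
           (length p \<le> 1 \<or> length p = 2 \<and> deep \<and> 4 \<le> card (N y))"
    and "y \<notin> D \<Longrightarrow> y \<noteq> w \<Longrightarrow> a \<in> N y \<inter> D \<Longrightarrow> a' \<in> N y \<inter> D \<Longrightarrow> a = a'"
    and "D \<subseteq> V"
proof -
  note d = assms[unfolded shape_def]
  show "u \<in> N w" using d by (elim conjE)
  show "D \<noteq> {} \<Longrightarrow> u \<in> D" using d by (elim conjE) (rule mp)
  from d have b: "\<And>a. a \<in> D \<Longrightarrow> card (N a) \<le> 3 \<and>
        (\<exists>p. nb_walk E (w # u # p) \<and> last (u # p) = a \<and> length p \<le> 2) \<and>
        (\<forall>y\<in>N a - D - {w}. \<exists>p. nb_walk E (w # u # p @ [y]) \<and>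
           (length p \<le> 1 \<or> length p = 2 \<and> deep \<and> 4 \<le> card (N y)))"
    by (elim conjE) (rule bspec)
  show "a \<in> D \<Longrightarrow> card (N a) \<le> 3"
    and "a \<in> D \<Longrightarrow> \<exists>p. nb_walk E (w # u # p) \<and> last (u # p) = a \<and> length p \<le> 2"
    using b by (simp_all only:)
  show "\<exists>p. nb_walk E (w # u # p @ [y]) \<and>
           (length p \<le> 1 \<or> length p = 2 \<and> deep \<and> 4 \<le> card (N y))"
    if "a \<in> D" "y \<in> N a" "y \<notin> D" "y \<noteq> w"
  proof -
    have "y \<in> N a - D - {w}" using that by simp
    then show ?thesis using b[OF that(1)] by (elim conjE) (rule bspec)
  qed
  show "y \<notin> D \<Longrightarrow> y \<noteq> w \<Longrightarrow> a \<in> N y \<inter> D \<Longrightarrow> a' \<in> N y \<inter> D \<Longrightarrow> a = a'"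
    using d by (elim conjE) (simp only: Ball_def, metis)
  show "D \<subseteq> V" using d by (elim conjE)
qed

lemma center_notin_shape:
  assumes "shape w u D deep"
  shows "w \<notin> D"
proof
  assume "w \<in> D"
  then obtain p where "nb_walk E (w # u # p)" "last (u # p) = w" "length p \<le> 2"
    using shapeD(4)[OF assms] by blast
  moreover from this have "distinct (w # u # p)" by (intro nb_walk_distinct) auto
  moreover have "last (u # p) \<in> set (u # p)" by (rule last_in_set) simp
  ultimately show False by auto
qed

lemma shapes_disjoint:
  assumes s: "shape w u D deep" "shape w u' D' deep'" and ne: "u \<noteq> u'"
  shows "D \<inter> D' = {}" "u \<notin> D'"
proof -
  show "D \<inter> D' = {}"
  proof (rule ccontr)
    assume "\<not> ?thesis"
    then obtain a where "a \<in> D" "a \<in> D'" by auto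
    then obtain p p' where "nb_walk E (w # u # p)" "last (u # p) = a" "length p \<le> 2"
      "nb_walk E (w # u' # p')" "last (u' # p') = a" "length p' \<le> 2"
      using shapeD(4)[OF s(1)] shapeD(4)[OF s(2)] by metis
    then show False using nb_walks_meet[of w u p u' p'] ne by auto
  qed
  show "u \<notin> D'"
  proof
    assume "u \<in> D'"
    then obtain p' where p': "nb_walk E (w # u' # p')" "last (u' # p') = u" "length p' \<le> 2"
      using shapeD(4)[OF s(2)] by metis
    have "nb_walk E [w, u]" using shapeD(1)[OF s(1)] N_sym by (simp add: edge_iff)
    then show False using nb_walks_meet[of w u "[]" u' p'] ne p' by auto
  qed
qed

lemma shapes_no_edge:
  assumes s: "shape w u D deep" "shape w u' D' deep'" and ne: "u \<noteq> u'"
    and a: "a \<in> D" and y: "y \<in> N a" "y \<in> D'"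
  shows False
proof -
  have "y \<notin> D" using shapes_disjoint[OF s ne] y by auto
  moreover have "y \<noteq> w" using center_notin_shape[OF s(2)] y by auto
  ultimately obtain p where p: "nb_walk E (w # u # p @ [y])"
    "length p \<le> 1 \<or> length p = 2 \<and> deep \<and> 4 \<le> card (N y)" using shapeD(5)[OF s(1) a y(1)] by blast
  \<comment> \<open>The deep alternative ends in a vertex of degree at least 4, but \<open>y\<close>
    is deleted and so has degree at most 3.\<close>
  have "length p \<le> 1" using p(2) shapeD(3)[OF s(2) y(2)] by linarith
  moreover obtain p' where "nb_walk E (w # u' # p')" "last (u' # p') = y" "length p' \<le> 2"
    using shapeD(4)[OF s(2) y(2)] by metis
  ultimately show False using nb_walks_meet[of w u "p @ [y]" u' p'] ne p(1) by auto
qed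

lemma center_outside_neighbor:
  assumes s: "shape w u D deep" and a: "a \<in> D" and y: "y \<in> N a" "y \<notin> D" "y \<in> N w"
  shows False
proof -
  have "y \<noteq> w" using y(3) N_irrefl by metis
  from shapeD(5)[OF s a y(1,2) this]
  obtain p where p: "nb_walk E (w # u # p @ [y])" "length p \<le> 2"
    by (elim exE conjE disjE) simp_all
  have "y \<noteq> u" using shapeD(2)[OF s] a y by auto
  moreover have "nb_walk E [w, y]" using y(3) N_sym by (simp add: edge_iff)
  ultimately show False using nb_walks_meet[of w u "p @ [y]" y "[]"] p by auto
qed

text \<open>An outer vertex with several deleted neighbors is the outer end of deep branches; as there
  are at most two of these, it keeps a colored neighbor.\<close>

lemma outer_vertex:
  assumes s: "\<And>u. u \<in> N w \<Longrightarrow> shape w u (D u) (u \<in> K)"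
    and K: "finite K" "card K \<le> 2"
    and S: "S = insert w (\<Union>u\<in>N w. D u)"
    and y: "y \<notin> S"
  shows "card (N y \<inter> S) \<le> 3" and "2 \<le> card (N y \<inter> S) \<Longrightarrow> 4 \<le> card (N y)"
proof -
  have yw: "y \<noteq> w" and yD: "y \<notin> D u" if "u \<in> N w" for u using y that unfolding S by simp_all
  define U where "U = {u \<in> N w. N y \<inter> D u \<noteq> {}}"
  have finU: "finite U" unfolding U_def by simp
  have one: "card (N y \<inter> D u) \<le> 1" if "u \<in> N w" for u
    using shapeD(6)[OF s[OF that] yD[OF that]] yw[OF that]
    by (metis One_nat_def card_le_Suc0_iff_eq finite_Int finite_N)
  have walk: "\<exists>p. nb_walk E (w # u # p @ [y]) \<and>
      (length p \<le> 1 \<or> length p = 2 \<and> u \<in> K \<and> 4 \<le> card (N y))" if u: "u \<in> U" for u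
  proof -
    obtain a where "u \<in> N w" "a \<in> N y" "a \<in> D u" using u unfolding U_def by blast
    then show ?thesis using shapeD(5)[OF s, of u a y] yD[of u] yw[of u] N_sym by blast
  qed
  have meet: "(u \<in> K \<or> u' \<in> K) \<and> 4 \<le> card (N y)" if uu: "u \<in> U" "u' \<in> U" "u \<noteq> u'" for u u'
  proof -
    obtain p where p: "nb_walk E (w # u # p @ [y])"
      "length p \<le> 1 \<or> length p = 2 \<and> u \<in> K \<and> 4 \<le> card (N y)" using walk[OF uu(1)] by blast
    obtain p' where p': "nb_walk E (w # u' # p' @ [y])"
      "length p' \<le> 1 \<or> length p' = 2 \<and> u' \<in> K \<and> 4 \<le> card (N y)" using walk[OF uu(2)] by blast
    \<comment> \<open>Two walks from \<open>w\<close> to \<open>y\<close> with at most 6 edges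
      together would contradict the girth; so one of the two branches is deep and \<open>y\<close>
      has degree at least 4.\<close>
    have "\<not> length p + length p' \<le> 2"
      using nb_walks_meet[OF p(1) p'(1) uu(3)] by auto
    then show ?thesis using p(2) p'(2) by linarith
  qed
  have cU: "card (N y \<inter> S) \<le> card U" if "w \<notin> N y"
  proof -
    have "N y \<inter> S = (\<Union>u\<in>U. N y \<inter> D u)" using that unfolding S U_def by auto
    then have "card (N y \<inter> S) \<le> (\<Sum>u\<in>U. card (N y \<inter> D u))" using card_UN_le[OF finU] by metis
    also have "\<dots> \<le> (\<Sum>u\<in>U. 1)" using one by (intro sum_mono) (auto simp: U_def)
    finally show ?thesis by simp
  qed
  have wN: "N y \<inter> S = {w}" if "w \<in> N y"
  proof -
    have "N y \<inter> D u = {}" if "u \<in> N w" for u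
      using center_outside_neighbor[OF s[OF that]] yD[OF that] N_sym \<open>w \<in> N y\<close> by blast
    then show ?thesis using that unfolding S by blast
  qed
  have "card U \<le> 3"
  proof -
    \<comment> \<open>At most one branch outside \<open>K\<close> reaches \<open>y\<close>; with at
      most two in \<open>K\<close> this makes three.\<close>
    have "card (U - K) \<le> Suc 0"
      using meet finU by (subst card_le_Suc0_iff_eq) auto
    moreover have "card U \<le> card (U - K) + card K"
      using diff_card_le_card_Diff[OF K(1), of U] by linarith
    ultimately show ?thesis using K by linarith
  qed
  then show "card (N y \<inter> S) \<le> 3" using cU wN by (cases "w \<in> N y") auto
  show "4 \<le> card (N y)" if two: "2 \<le> card (N y \<inter> S)"
  proof -
    have "2 \<le> card U" using two cU wN by (cases "w \<in> N y") auto
    then obtain u u' where "u \<in> U" "u' \<in> U" "u \<noteq> u'" unfolding card_ge_2_iff by auto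
    then show ?thesis using meet by blast
  qed
qed

end

section \<open>Recoloring a center and its branches\<close>

text \<open>Minimality is kept only as the colorability of what remains after deleting any nonempty
  set; the values of that coloring on the deleted set are arbitrary. Sparsity enters in the final
  induction, against the edge count derived in this locale.\<close>

locale minimal_counterexample = girth_7_graph V E for V :: "'a set" and E +
  fixes L :: "'a \<Rightarrow> 'c set"
  assumes lists: "v \<in> V \<Longrightarrow> finite (L v) \<and> card (neighborhood E v) + 2 \<le> card (L v)"
    and smaller: "S \<subseteq> V \<Longrightarrow> S \<noteq> {} \<Longrightarrow> \<exists>\<phi>. \<forall>v\<in>V - S. \<phi> v \<in> L v \<and>
          (\<forall>u\<in>neighborhood E v - S. \<phi> u \<noteq> \<phi> v) \<and>
          (neighborhood E v - S \<noteq> {} \<longrightarrow> uniq \<phi> (neighborhood E v - S))"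
    and no_coloring: "\<not> (\<forall>v\<in>V. \<psi> v \<in> L v \<and> (\<forall>u\<in>neighborhood E v. \<psi> u \<noteq> \<psi> v) \<and>
          (neighborhood E v \<noteq> {} \<longrightarrow> uniq \<psi> (neighborhood E v)))"
begin

definition good :: "('a \<Rightarrow> 'c) \<Rightarrow> 'a set \<Rightarrow> bool" where
  "good \<phi> S \<longleftrightarrow> (\<forall>v\<in>V - S. \<phi> v \<in> L v \<and> (\<forall>u\<in>N v - S. \<phi> u \<noteq> \<phi> v) \<and>
      (N v - S \<noteq> {} \<longrightarrow> uniq \<phi> (N v - S)))"

text \<open>A colored vertex forbids at most one color on its uncolored neighbors, and none at all if it
  has degree 3 and one uncolored neighbor: the two others already have distinct colors.\<close>

lemma ex_forbidden_color:
  assumes good: "good \<phi> S" and y: "y \<in> V - S"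
    and few: "card (N y \<inter> S) \<le> 3" and many: "2 \<le> card (N y \<inter> S) \<Longrightarrow> 4 \<le> card (N y)"
  shows "\<exists>C. finite C \<and> card C \<le> 1 \<and> (card (N y) = 3 \<longrightarrow> C = {}) \<and>
    (\<forall>\<psi>. (\<forall>x. x \<notin> S \<longrightarrow> \<psi> x = \<phi> x) \<longrightarrow> (\<forall>x\<in>N y \<inter> S. \<psi> x \<notin> C) \<longrightarrow> N y \<noteq> {} \<longrightarrow> uniq \<psi> (N y))"
proof (cases "N y - S = {}")
  case True
  then have "N y \<inter> S = N y" by auto
  \<comment> \<open>If all neighbors are uncolored, two or more of them would have to be at least 4
    and at most 3.\<close>
  then have "card (N y) \<le> Suc 0" using few many by (cases "2 \<le> card (N y)") simp_all
  then have "\<forall>a\<in>N y. \<forall>b\<in>N y. a = b" by (simp add: card_le_Suc0_iff_eq)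
  then have "N y \<noteq> {} \<longrightarrow> uniq \<psi> (N y)" for \<psi> :: "'a \<Rightarrow> 'c" unfolding uniq_def by blast
  then show ?thesis by (intro exI[of _ "{}"]) simp
next
  case False
  then have u: "uniq \<phi> (N y - S)" using good y unfolding good_def by blast
  then obtain a where a: "a \<in> N y" "a \<notin> S" "\<And>b. b \<in> N y \<Longrightarrow> b \<notin> S \<Longrightarrow> \<phi> b = \<phi> a \<Longrightarrow> b = a"
    unfolding uniq_def by blast
  show ?thesis
  proof (cases "card (N y) = 3")
    case False
    have "uniq \<psi> (N y)" if "\<forall>x. x \<notin> S \<longrightarrow> \<psi> x = \<phi> x" "\<forall>x\<in>N y \<inter> S. \<psi> x \<notin> {\<phi> a}" for \<psi>
      unfolding uniq_def using that a by (intro bexI[of _ a]) (metis IntI insertI1, simp)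
    then show ?thesis using False by (intro exI[of _ "{\<phi> a}"]) simp
  next
    case True
    have c: "card (N y \<inter> S) \<le> 1" using many True by fastforce
    have "uniq \<psi> (N y)" if agree: "\<forall>x. x \<notin> S \<longrightarrow> \<psi> x = \<phi> x" for \<psi>
    proof (cases "N y \<inter> S = {}")
      case True
      then have "N y - S = N y" by auto
      then show ?thesis using u agree True uniq_cong[of \<phi> "N y" \<psi>] by auto
    next
      case False
      then have "card (N y \<inter> S) = 1" using c by (simp add: card_gt_0_iff le_antisym Suc_leI)
      then obtain x where x: "N y \<inter> S = {x}" by (auto simp: card_1_singleton_iff)
      have "card (N y - S) = 2" using True x by (simp add: card_Diff_subset_Int)
      then have "card (N y - S - {a}) = 1" using a by simp
      then obtain b where "N y - S - {a} = {b}" by (auto simp: card_1_singleton_iff)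
      then have b: "b \<in> N y" "b \<notin> S" "b \<noteq> a" "N y = {a, b, x}" using x a by auto
      then have "\<psi> b \<noteq> \<psi> a" using a agree by metis
      then show ?thesis unfolding b(4) by (intro uniq_insert3) simp
    qed
    then show ?thesis by (intro exI[of _ "{}"]) simp
  qed
qed

definition ok_at :: "('a \<Rightarrow> 'c) \<Rightarrow> 'a set \<Rightarrow> ('a \<Rightarrow> 'c set) \<Rightarrow> 'a \<Rightarrow> bool" where
  "ok_at \<psi> S C x \<longleftrightarrow> \<psi> x \<in> L x \<and> (\<forall>y\<in>N x. \<psi> y \<noteq> \<psi> x) \<and> uniq \<psi> (N x) \<and> (\<forall>y\<in>N x - S. \<psi> x \<notin> C y)"

text \<open>The colors that the neighbor \<open>u\<close> of the center can get if the center gets color \<open>\<gamma>\<close>.\<close>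

definition branch_colors ::
    "'a set \<Rightarrow> ('a \<Rightarrow> 'c) \<Rightarrow> ('a \<Rightarrow> 'c set) \<Rightarrow> 'a \<Rightarrow> 'a \<Rightarrow> 'a set \<Rightarrow> 'c \<Rightarrow> 'c set" where
  "branch_colors S \<phi> C w u D \<gamma> =
     {p. \<exists>\<psi>. \<psi> w = \<gamma> \<and> (\<forall>x. x \<notin> S \<longrightarrow> \<psi> x = \<phi> x) \<and> (\<forall>x\<in>D. ok_at \<psi> S C x) \<and> \<psi> u = p}"

definition forbids :: "'a set \<Rightarrow> ('a \<Rightarrow> 'c set) \<Rightarrow> bool" where
  "forbids S C \<longleftrightarrow> (\<forall>y\<in>V - S. finite (C y) \<and> card (C y) \<le> 1 \<and> (card (N y) = 3 \<longrightarrow> C y = {}))"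

text \<open>\<open>Q F P\<close> is to hold for the set \<open>F\<close> of colors that the branch forbids at the center and the
  family \<open>P\<close> of its color sets.\<close>

definition branch ::
    "'a \<Rightarrow> 'a \<Rightarrow> 'a set \<Rightarrow> ('c set \<Rightarrow> ('c \<Rightarrow> 'c set) \<Rightarrow> bool) \<Rightarrow> bool" where
  "branch w u D Q \<longleftrightarrow> (\<forall>S \<phi> C. forbids S C \<longrightarrow> D \<subseteq> S \<longrightarrow> w \<in> S \<longrightarrow> (\<forall>a\<in>D. N a \<inter> S \<subseteq> insert w D) \<longrightarrow>
     (D = {} \<longrightarrow> u \<notin> S) \<longrightarrow>
     (\<exists>F. finite F \<and> (D = {} \<longrightarrow> insert (\<phi> u) (C u) \<subseteq> F) \<and> Q F (branch_colors S \<phi> C w u D)))"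

text \<open>Gluing: distinct branches share no vertex and are joined by no edge, so colorings of
  single branches that agree at \<open>w\<close> and outside \<open>S\<close> combine to one of the
  whole graph. \<open>F\<close> and \<open>P\<close> depend on the coloring of the rest. The
  conclusion is an impossibility, so that a configuration is refuted by exhibiting
  \<open>\<gamma>\<close> and \<open>p\<close>.\<close>

lemma center_extension:
  assumes w: "w \<in> V" and s: "\<And>u. u \<in> N w \<Longrightarrow> shape w u (D u) (u \<in> K)"
    and K: "finite K" "card K \<le> 2"
    and br: "\<And>u. u \<in> N w \<Longrightarrow> branch w u (D u) (Q u)"
  shows "\<exists>F P. (\<forall>u\<in>N w. finite (F u) \<and> Q u (F u) (P u)) \<and>
    \<not> (\<exists>\<gamma>\<in>L w. \<exists>p. (\<forall>u\<in>N w. \<gamma> \<notin> F u \<and> p u \<in> P u \<gamma>) \<and> (N w \<noteq> {} \<longrightarrow> uniq p (N w)))"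
proof -
  define S where "S = insert w (\<Union>u\<in>N w. D u)"
  have "S \<subseteq> V" using w shapeD(7)[OF s] unfolding S_def by blast
  from smaller[OF this] obtain \<phi> where phi: "good \<phi> S" unfolding good_def S_def by blast
  have inS: "w \<in> S" "u \<in> N w \<Longrightarrow> D u \<subseteq> S" for u unfolding S_def by auto
  have outer: "card (N y \<inter> S) \<le> 3" "2 \<le> card (N y \<inter> S) \<Longrightarrow> 4 \<le> card (N y)" if "y \<notin> S" for y
    using outer_vertex[of w D K S y, OF _ K S_def that] s by simp_all
  have "\<exists>C. \<forall>y\<in>V - S. finite (C y) \<and> card (C y) \<le> 1 \<and> (card (N y) = 3 \<longrightarrow> C y = {}) \<and>
    (\<forall>\<psi>. (\<forall>x. x \<notin> S \<longrightarrow> \<psi> x = \<phi> x) \<longrightarrow> (\<forall>x\<in>N y \<inter> S. \<psi> x \<notin> C y) \<longrightarrow> N y \<noteq> {} \<longrightarrow> uniq \<psi> (N y))"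
    by (rule bchoice) (use ex_forbidden_color[OF phi] outer in simp)
  then obtain C where C': "\<forall>y\<in>V - S. finite (C y) \<and> card (C y) \<le> 1 \<and> (card (N y) = 3 \<longrightarrow> C y = {}) \<and>
    (\<forall>\<psi>. (\<forall>x. x \<notin> S \<longrightarrow> \<psi> x = \<phi> x) \<longrightarrow> (\<forall>x\<in>N y \<inter> S. \<psi> x \<notin> C y) \<longrightarrow> N y \<noteq> {} \<longrightarrow> uniq \<psi> (N y))"
    by (elim exE)
  have C1: "forbids S C" unfolding forbids_def using C'
    by (simp only: ball_conj_distrib) (elim conjE, intro conjI, assumption+)
  have C2: "uniq \<psi> (N y)" if "y \<in> V - S" "\<forall>x. x \<notin> S \<longrightarrow> \<psi> x = \<phi> x"
    "\<forall>x\<in>N y \<inter> S. \<psi> x \<notin> C y" "N y \<noteq> {}" for y \<psi>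
    using bspec[OF C' that(1), THEN conjunct2, THEN conjunct2, THEN conjunct2, THEN spec,
        THEN mp, THEN mp, THEN mp, OF that(2-4)] .
  have local: "N a \<inter> S \<subseteq> insert w (D u)" if "u \<in> N w" "a \<in> D u" for u a
    using shapes_no_edge[OF s[OF that(1)] s] that(2) unfolding S_def by blast
  have outer_u: "u \<notin> S" if "u \<in> N w" "D u = {}" for u
    using shapes_disjoint(2)[OF s[OF that(1)] s] that N_irrefl unfolding S_def by blast
  define P where "P u = branch_colors S \<phi> C w u (D u)" for u
  have "\<exists>F. finite F \<and> (D u = {} \<longrightarrow> insert (\<phi> u) (C u) \<subseteq> F) \<and> Q u F (P u)" if "u \<in> N w" for u
    unfolding P_def
    by (rule br[OF that, unfolded branch_def, rule_format]) (use C1 inS local outer_u that in auto)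
  then obtain F where F: "\<And>u. u \<in> N w \<Longrightarrow> finite (F u) \<and> (D u = {} \<longrightarrow> insert (\<phi> u) (C u) \<subseteq> F u) \<and> Q u (F u) (P u)"
    by metis
  have False if g: "\<gamma> \<in> L w" and p: "\<forall>u\<in>N w. \<gamma> \<notin> F u \<and> p u \<in> P u \<gamma>"
    and un: "N w \<noteq> {} \<longrightarrow> uniq p (N w)" for \<gamma> p
  proof -
    have "\<forall>u\<in>N w. \<exists>\<psi>. \<psi> w = \<gamma> \<and> (\<forall>x. x \<notin> S \<longrightarrow> \<psi> x = \<phi> x) \<and> (\<forall>x\<in>D u. ok_at \<psi> S C x) \<and> \<psi> u = p u"
      using p unfolding P_def branch_colors_def by blast
    then obtain \<theta> where th: "\<And>u. u \<in> N w \<Longrightarrow> \<theta> u w = \<gamma>"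
      "\<And>u x. u \<in> N w \<Longrightarrow> x \<notin> S \<Longrightarrow> \<theta> u x = \<phi> x"
      "\<And>u x. u \<in> N w \<Longrightarrow> x \<in> D u \<Longrightarrow> ok_at (\<theta> u) S C x"
      "\<And>u. u \<in> N w \<Longrightarrow> \<theta> u u = p u"
      by (metis (no_types, lifting))
    define h where "h x = (SOME u. u \<in> N w \<and> x \<in> D u)" for x
    have h: "h x = u" if "u \<in> N w" "x \<in> D u" for x u
    proof -
      have "h x \<in> N w \<and> x \<in> D (h x)" unfolding h_def by (rule someI[of _ u]) (use that in simp)
      then show ?thesis using shapes_disjoint(1)[OF s s, of "h x" u] that by blast
    qed
    define \<psi> where "\<psi> x = (if x = w then \<gamma> else if x \<in> S then \<theta> (h x) x else \<phi> x)" for x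
    have psi: "\<psi> w = \<gamma>" "\<And>x. x \<notin> S \<Longrightarrow> \<psi> x = \<phi> x" using inS(1) unfolding \<psi>_def by auto
    have psiD: "\<psi> x = \<theta> u x" if "u \<in> N w" "x \<in> D u" for x u
      using h[OF that] that inS(2)[OF that(1)] center_notin_shape[OF s[OF that(1)]] unfolding \<psi>_def by auto
    have psiN: "\<psi> y = \<theta> u y" if "u \<in> N w" "x \<in> D u" "y \<in> N x" for x y u
      using local[OF that(1,2)] that psiD[OF that(1)] psi th(1,2)[OF that(1)] by (cases "y \<in> S") auto
    have psip: "\<psi> u = p u" if u: "u \<in> N w" for u
    proof (cases "D u = {}")
      case True
      then show ?thesis using outer_u[OF u] psi(2) th(2)[OF u, of u] th(4)[OF u] by auto
    next
      case False
      then show ?thesis using shapeD(2)[OF s[OF u] False] psiD[OF u] th(4)[OF u] by auto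
    qed
    \<comment> \<open>A neighbor of \<open>w\<close> that kept its color has an empty branch; a
      color of \<open>w\<close> outside \<open>F\<close> then respects both its color and the unique
      color around it.\<close>
    have outer_F: "D v = {} \<and> insert (\<phi> v) (C v) \<subseteq> F v" if "v \<in> N w" "v \<notin> S" for v
      using F[OF that(1)] shapeD(2)[OF s[OF that(1)]] inS(2)[OF that(1)] that(2) by blast
    have "\<psi> v \<in> L v \<and> (\<forall>u\<in>N v. \<psi> u \<noteq> \<psi> v) \<and> (N v \<noteq> {} \<longrightarrow> uniq \<psi> (N v))" if v: "v \<in> V" for v
    proof -
      consider "v = w" | u where "u \<in> N w" "v \<in> D u" | "v \<notin> S" unfolding S_def by blast
      then show ?thesis
      proof cases
        case 1
        have "\<psi> u \<noteq> \<gamma>" if u: "u \<in> N w" for u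
        proof (cases "D u = {}")
          case True
          then show ?thesis using F[OF u] outer_u[OF u] psi(2) p u by auto
        next
          case False
          then have "ok_at (\<theta> u) S C u" "u \<in> D u" using th(3)[OF u] shapeD(2)[OF s[OF u]] by auto
          then show ?thesis using psiD[OF u] th(1)[OF u] N_sym[OF u] unfolding ok_at_def by metis
        qed
        moreover have "N w \<noteq> {} \<longrightarrow> uniq \<psi> (N w)" using un psip uniq_cong[of p "N w" \<psi>] by auto
        ultimately show ?thesis using 1 g psi by auto
      next
        case 2
        then have ok: "ok_at (\<theta> u) S C v" using th(3) by blast
        then have "uniq \<psi> (N v)" using uniq_cong[of "\<theta> u" "N v" \<psi>] psiN[OF 2] unfolding ok_at_def by auto
        then show ?thesis using ok psiN[OF 2] psiD[OF 2] unfolding ok_at_def by auto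
      next
        case 3
        have g3: "\<phi> v \<in> L v" "\<forall>u\<in>N v - S. \<phi> u \<noteq> \<phi> v" using phi v 3 unfolding good_def by auto
        have nb: "\<psi> x \<noteq> \<phi> v \<and> \<psi> x \<notin> C v" if x: "x \<in> N v" "x \<in> S" for x
        proof (cases "x = w")
          case True
          then have vw: "v \<in> N w" using x N_sym by blast
          then show ?thesis using outer_F[OF vw 3] p True psi(1) by auto
        next
          case False
          then obtain u where u: "u \<in> N w" "x \<in> D u" using x unfolding S_def by blast
          then have "ok_at (\<theta> u) S C x" "v \<in> N x" using th(3) N_sym x by blast+
          then show ?thesis using psiD[OF u] th(2)[OF u(1) 3] 3 unfolding ok_at_def by (metis DiffI)
        qed
        have "N v \<noteq> {} \<longrightarrow> uniq \<psi> (N v)" using C2[of v \<psi>] v 3 psi(2) nb by blast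
        moreover have "\<psi> u \<noteq> \<psi> v" if "u \<in> N v" for u
          using that nb g3(2) psi(2) 3 by (cases "u \<in> S") auto
        ultimately show ?thesis using g3(1) psi(2)[OF 3] by auto
      qed
    qed
    then show False using no_coloring[of \<psi>] by blast
  qed
  then have "\<not> (\<exists>\<gamma>\<in>L w. \<exists>p. (\<forall>u\<in>N w. \<gamma> \<notin> F u \<and> p u \<in> P u \<gamma>) \<and> (N w \<noteq> {} \<longrightarrow> uniq p (N w)))"
    by blast
  then show ?thesis using F by (intro exI[of _ F] exI[of _ P]) simp
qed

end

section \<open>The types of branches\<close>

text \<open>The neighbor of the center keeps its color \<open>x\<close>. Since \<open>x\<close> lies
  in \<open>F\<close>, every admissible color of the center differs from it.\<close>

definition fixed_branch :: "nat \<Rightarrow> 'c set \<Rightarrow> ('c \<Rightarrow> 'c set) \<Rightarrow> bool" where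
  "fixed_branch k F P \<longleftrightarrow> card F \<le> k \<and> (\<exists>x\<in>F. \<forall>\<gamma>. P \<gamma> = {x})"

text \<open>\<open>A\<close> is what the far neighbor leaves in the list of a deleted vertex of
  degree 2. It is the same set for all \<open>\<gamma>\<close>, which makes it possible to compare
  two colors of the center.\<close>

definition link_branch :: "nat \<Rightarrow> 'c set \<Rightarrow> ('c \<Rightarrow> 'c set) \<Rightarrow> bool" where
  "link_branch k F P \<longleftrightarrow> card F \<le> 1 \<and> (\<exists>A. k \<le> card A \<and> (\<forall>\<gamma>. \<gamma> \<notin> F \<longrightarrow> A - {\<gamma>} \<subseteq> P \<gamma>))"

definition heavy_branch :: "nat \<Rightarrow> 'c set \<Rightarrow> ('c \<Rightarrow> 'c set) \<Rightarrow> bool" where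
  "heavy_branch b F P \<longleftrightarrow> F = {} \<and> (\<exists>B. finite B \<and> card B \<le> b \<and>
     (\<forall>\<gamma>. P \<gamma> \<noteq> {} \<and> (\<gamma> \<notin> B \<longrightarrow> (\<exists>p\<in>P \<gamma>. \<exists>q\<in>P \<gamma>. p \<noteq> q))))"

context girth_7_graph
begin

lemma shapeI:
  assumes "u \<in> N w" "D \<subseteq> V" "u \<in> D" "\<And>a. a \<in> D \<Longrightarrow> card (N a) \<le> 3"
    and "\<And>a. a \<in> D \<Longrightarrow> \<exists>p. nb_walk E (w # u # p) \<and> last (u # p) = a \<and> length p \<le> 2"
    and "\<And>a y. a \<in> D \<Longrightarrow> y \<in> N a \<Longrightarrow> y \<notin> D \<Longrightarrow> y \<noteq> w \<Longrightarrow> \<exists>p. nb_walk E (w # u # p @ [y]) \<and>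
           (length p \<le> 1 \<or> length p = 2 \<and> deep \<and> 4 \<le> card (N y))"
    and "\<And>y a a'. y \<notin> D \<Longrightarrow> y \<noteq> w \<Longrightarrow> a \<in> D \<Longrightarrow> a' \<in> D \<Longrightarrow> y \<in> N a \<Longrightarrow> y \<in> N a' \<Longrightarrow> a = a'"
  shows "shape w u D deep"
  unfolding shape_def
proof (intro conjI allI impI ballI)
  fix y a a'
  assume "y \<notin> D" "y \<noteq> w" "a \<in> N y \<inter> D" "a' \<in> N y \<inter> D"
  then show "a = a'" using assms(7)[of y a a'] N_sym by simp
qed (use assms(1-6) in simp_all)

lemma shape_empty: "u \<in> N w \<Longrightarrow> shape w u {} deep"
  unfolding shape_def by simp

lemma N_eq_subset: "N x = insert a A \<Longrightarrow> x \<in> V"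
  using N_subset[of a] N_sym[of a x] by auto

end

context minimal_counterexample
begin

section \<open>Colors that remain available at deleted vertices\<close>

lemma list_remaining:
  assumes "N x = insert a A" "card (N x) = n" "finite F" "card F + k \<le> n + 2"
  shows "k \<le> card (L x - F)"
proof -
  have "card (N x) + 2 \<le> card (L x)" using lists N_eq_subset assms(1) by blast
  then show ?thesis using diff_card_le_card_Diff[OF assms(3), of "L x"] assms(2,4) by linarith
qed

lemma list_one:
  assumes "N x = insert a A" "2 \<le> card (N x)"
  shows "\<exists>p\<in>L x. p \<notin> {b, c, d}"
proof -
  have "card {b, c, d} + 1 \<le> card (N x) + 2" using assms(2) card_insert_le2(2)[of b c d] by linarith
  then have "1 \<le> card (L x - {b, c, d})" by (intro list_remaining[OF assms(1) refl]) auto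
  then have "L x - {b, c, d} \<noteq> {}" by (metis card.empty not_one_le_zero)
  then show ?thesis by blast
qed

lemma list_two:
  assumes "N x = insert a A" "2 \<le> card (N x)"
  shows "\<exists>p\<in>L x. \<exists>q\<in>L x. p \<notin> {b, c} \<and> q \<notin> {b, c} \<and> p \<noteq> q"
proof -
  have "card {b, c} + 2 \<le> card (N x) + 2" using assms(2) card_insert_le2(1)[of b c] by linarith
  then have "2 \<le> card (L x - {b, c})" by (intro list_remaining[OF assms(1) refl]) auto
  then show ?thesis unfolding card_ge_2_iff by blast
qed

lemma forbids_card:
  assumes "forbids S C" "y \<in> N x" "y \<notin> S"
  shows "finite (insert c (C y))" "card (insert c (C y)) \<le> 2"
    "card (N y) = 3 \<Longrightarrow> C y = {}"
proof -
  have y: "y \<in> V - S" using assms N_subset by auto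
  have f: "finite (C y)" "card (C y) \<le> 1" "card (N y) = 3 \<longrightarrow> C y = {}"
    using assms(1)[unfolded forbids_def, rule_format, OF y] by simp_all
  show "finite (insert c (C y))" using f by simp
  show "card (insert c (C y)) \<le> 2" using f by (simp add: card_insert_if)
  show "card (N y) = 3 \<Longrightarrow> C y = {}" using f by simp
qed

text \<open>The center must avoid the color of \<open>u\<close> and the color whose single
  occurrence around \<open>u\<close> is to be preserved; at degree 3 nothing has to be
  preserved.\<close>

lemma branch_fixed:
  assumes u: "u \<in> N w"
  shows "branch w u {} (fixed_branch (if card (N u) = 3 then 1 else 2))"
  unfolding branch_def
proof (intro allI impI)
  fix S \<phi> C
  assume S: "forbids S C" "w \<in> S" and "{} = {} \<longrightarrow> u \<notin> S"
  then have uS: "u \<notin> S" by simp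
  note f = forbids_card[OF S(1) u uS]
  have "branch_colors S \<phi> C w u {} \<gamma> = {\<phi> u}" for \<gamma>
  proof -
    have "\<phi> u \<in> branch_colors S \<phi> C w u {} \<gamma>"
      unfolding branch_colors_def using S(2) uS
      by (auto intro!: exI[of _ "\<phi>(w := \<gamma>)"])
    then show ?thesis using uS unfolding branch_colors_def by auto
  qed
  moreover have "card (insert (\<phi> u) (C u)) \<le> (if card (N u) = 3 then 1 else 2)"
    using f(2) f(3) by auto
  ultimately show "\<exists>F. finite F \<and> ({} = {} \<longrightarrow> insert (\<phi> u) (C u) \<subseteq> F) \<and>
      fixed_branch (if card (N u) = 3 then 1 else 2) F (branch_colors S \<phi> C w u {})"
    using f(1) unfolding fixed_branch_def by (intro exI[of _ "insert (\<phi> u) (C u)"]) auto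
qed

lemma shape_link:
  assumes u: "N u = {w, y}" "w \<noteq> y"
  shows "shape w u {u} deep"
proof (rule shapeI)
  show uw: "u \<in> N w" using u(1) N_sym by auto
  show "{u} \<subseteq> V" using N_eq_subset[OF u(1)] by simp
  show "\<exists>p. nb_walk E (w # u # p) \<and> last (u # p) = a \<and> length p \<le> 2" if "a \<in> {u}" for a
    using that uw N_sym by (intro exI[of _ "[]"]) (simp add: edge_iff)
  show "\<exists>p. nb_walk E (w # u # p @ [y']) \<and> (length p \<le> 1 \<or> length p = 2 \<and> deep \<and> 4 \<le> card (N y'))"
    if "a \<in> {u}" "y' \<in> N a" "y' \<notin> {u}" "y' \<noteq> w" for a y'
    using that u uw N_sym by (intro exI[of _ "[]"]) (auto simp: edge_iff)
qed (use u in \<open>auto simp: card_insert_if\<close>)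

text \<open>As \<open>u\<close> sees only \<open>w\<close> and \<open>y\<close>, it has a unique
  color around it exactly if \<open>\<gamma>\<close> differs from the color of \<open>y\<close>:
  this is the one forbidden color. The list of \<open>u\<close> has four colors, of which
  \<open>y\<close> takes two, or only one if it has degree 3.\<close>

lemma branch_link:
  assumes u: "N u = {w, y}" "w \<noteq> y"
  shows "branch w u {u} (link_branch (if card (N y) = 3 then 3 else 2))"
  unfolding branch_def
proof (intro allI impI)
  fix S \<phi> C
  assume S: "forbids S C" "{u} \<subseteq> S" "w \<in> S" and loc: "\<forall>a\<in>{u}. N a \<inter> S \<subseteq> {w, u}"
  have d: "u \<noteq> w" "u \<noteq> y" using u(1) N_irrefl[of u] by auto
  have yS: "y \<notin> S" using loc u d by auto
  have y: "y \<in> N u" using u(1) by simp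
  note f = forbids_card[OF S(1) y yS]
  define A where "A = L u - insert (\<phi> y) (C y)"
  have A: "(if card (N y) = 3 then 3 else 2) \<le> card A"
    unfolding A_def using f f(2)[of "\<phi> y"] u by (intro list_remaining[OF u(1), of 2]) auto
  have "p \<in> branch_colors S \<phi> C w u {u} \<gamma>" if "\<gamma> \<noteq> \<phi> y" "p \<in> A" "p \<noteq> \<gamma>" for p \<gamma>
  proof -
    let ?\<psi> = "\<phi>(w := \<gamma>, u := p)"
    have "uniq ?\<psi> {w, y}" using d u(2) that by (intro uniq_insert2) auto
    then have "ok_at ?\<psi> S C u" unfolding ok_at_def using that d u S(2,3) yS by (auto simp: A_def)
    then show ?thesis unfolding branch_colors_def using d S(2,3) by (auto intro!: exI[of _ ?\<psi>])
  qed
  then have "link_branch (if card (N y) = 3 then 3 else 2) {\<phi> y} (branch_colors S \<phi> C w u {u})"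
    unfolding link_branch_def using A by (intro conjI exI[of _ A]) auto
  then show "\<exists>F. finite F \<and> ({u} = {} \<longrightarrow> insert (\<phi> u) (C u) \<subseteq> F) \<and>
      link_branch (if card (N y) = 3 then 3 else 2) F (branch_colors S \<phi> C w u {u})"
    by (intro exI[of _ "{\<phi> y}"]) simp
qed

lemma heavy_branchI:
  assumes D: "D \<noteq> {}"
    and *: "\<And>S \<phi> C. forbids S C \<Longrightarrow> D \<subseteq> S \<Longrightarrow> w \<in> S \<Longrightarrow> \<forall>a\<in>D. N a \<inter> S \<subseteq> insert w D \<Longrightarrow>
      \<exists>B. finite B \<and> card B \<le> b \<and> (\<forall>\<gamma>. branch_colors S \<phi> C w u D \<gamma> \<noteq> {} \<and>
        (\<gamma> \<notin> B \<longrightarrow> (\<exists>p\<in>branch_colors S \<phi> C w u D \<gamma>. \<exists>q\<in>branch_colors S \<phi> C w u D \<gamma>. p \<noteq> q)))"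
  shows "branch w u D (heavy_branch b)"
  unfolding branch_def heavy_branch_def
  by (intro allI impI exI[of _ "{}"]) (use D * in simp)

lemma shape_thread2:
  assumes u: "N u = {w, v}" "w \<noteq> v" and v: "N v = {u, y}" "u \<noteq> y"
  shows "shape w u {u, v} deep"
proof (rule shapeI)
  show uw: "u \<in> N w" using u(1) N_sym by auto
  have e: "{w, u} \<in> E" "{u, v} \<in> E" "{v, y} \<in> E"
    using N_eq_D[OF u(1)] N_eq_D[OF v(1)] v by (auto simp: insert_commute edge_iff intro: N_sym)
  show "{u, v} \<subseteq> V" using N_eq_subset[OF u(1)] N_eq_subset[OF v(1)] by simp
  show "\<exists>p. nb_walk E (w # u # p) \<and> last (u # p) = a \<and> length p \<le> 2" if "a \<in> {u, v}" for a
  proof (cases "a = u")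
    case True
    then show ?thesis using e by (intro exI[of _ "[]"]) simp
  next
    case False
    then show ?thesis using e u that by (intro exI[of _ "[v]"]) simp
  qed
  show "\<exists>p. nb_walk E (w # u # p @ [y']) \<and> (length p \<le> 1 \<or> length p = 2 \<and> deep \<and> 4 \<le> card (N y'))"
    if "a \<in> {u, v}" "y' \<in> N a" "y' \<notin> {u, v}" "y' \<noteq> w" for a y'
    using that u v e by (intro exI[of _ "[v]"]) auto
qed (use u v in \<open>auto simp: card_insert_if\<close>)

text \<open>With colors \<open>p\<close> at \<open>u\<close> and \<open>q\<close> at
  \<open>v\<close>, uniqueness at \<open>u\<close> means that \<open>q\<close> is not
  \<open>\<gamma>\<close>, and at \<open>v\<close> that \<open>p\<close> is not the color of
  \<open>y\<close>. Choosing \<open>q\<close> first leaves one of four colors for \<open>p\<close>.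
  For two choices of \<open>p\<close> each needs its own \<open>q\<close>, which exists as soon as
  \<open>A - {\<gamma>}\<close> has two colors.\<close>

lemma branch_thread2:
  assumes u: "N u = {w, v}" "w \<noteq> v" and v: "N v = {u, y}" "u \<noteq> y"
  shows "branch w u {u, v} (heavy_branch 2)"
proof (rule heavy_branchI)
  fix S \<phi> C
  assume S: "forbids S C" "{u, v} \<subseteq> S" "w \<in> S" and loc: "\<forall>a\<in>{u, v}. N a \<inter> S \<subseteq> insert w {u, v}"
  have "nb_walk E [w, u, v, y]"
    using N_eq_D[OF u(1)] N_eq_D[OF v(1)] u v by (auto simp: insert_commute edge_iff intro: N_sym)
  then have "distinct [w, u, v, y]" by (rule nb_walk_distinct) simp
  then have d: "w \<noteq> u" "w \<noteq> v" "w \<noteq> y" "u \<noteq> v" "u \<noteq> y" "v \<noteq> y" by auto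
  have yS: "y \<notin> S" using loc v d by auto
  have y: "y \<in> N v" using v(1) by simp
  note f = forbids_card[OF S(1) y yS]
  define A where "A = L v - insert (\<phi> y) (C y)"
  have A: "2 \<le> card A" unfolding A_def using f f(2)[of "\<phi> y"] v by (intro list_remaining[OF v(1), of 2]) auto
  let ?P = "branch_colors S \<phi> C w u {u, v}"
  have P: "p \<in> ?P \<gamma>" if "p \<in> L u" "p \<noteq> \<gamma>" "p \<noteq> \<phi> y" "q \<in> A" "q \<noteq> \<gamma>" "q \<noteq> p" for p q \<gamma>
  proof -
    let ?\<psi> = "\<phi>(w := \<gamma>, u := p, v := q)"
    have "uniq ?\<psi> {w, v}" "uniq ?\<psi> {u, y}" using d that by (intro uniq_insert2; simp)+
    then have "ok_at ?\<psi> S C u" "ok_at ?\<psi> S C v"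
      unfolding ok_at_def using that d u v S(2,3) yS by (auto simp: A_def)
    then show ?thesis unfolding branch_colors_def using d S(2,3) by (auto intro!: exI[of _ ?\<psi>])
  qed
  have cu: "2 \<le> card (N u)" using u by simp
  obtain B where B: "finite B" "card B \<le> 2" "\<And>\<gamma>. \<gamma> \<notin> B \<Longrightarrow> 2 \<le> card (A - {\<gamma>})"
    using bad_colors[OF A] by auto
  have "?P \<gamma> \<noteq> {}" for \<gamma>
  proof -
    obtain q where q: "q \<in> A" "q \<noteq> \<gamma>" using ex_remaining[of "{\<gamma>}" A] A by auto
    obtain p where "p \<in> L u" "p \<notin> {\<gamma>, \<phi> y, q}" using list_one[OF u(1) cu] by blast
    then show ?thesis using P[of p \<gamma> q] q by auto
  qed
  moreover have "\<exists>p\<in>?P \<gamma>. \<exists>q\<in>?P \<gamma>. p \<noteq> q" if "\<gamma> \<notin> B" for \<gamma>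
  proof -
    obtain p p' where p: "p \<in> L u" "p \<notin> {\<gamma>, \<phi> y}" "p' \<in> L u" "p' \<notin> {\<gamma>, \<phi> y}" "p \<noteq> p'"
      using list_two[OF u(1) cu] by blast
    have "\<exists>q\<in>A. q \<noteq> \<gamma> \<and> q \<noteq> c" for c
      using ex_remaining[of "{c}" "A - {\<gamma>}"] B(3)[OF that] by auto
    then have "p \<in> ?P \<gamma>" "p' \<in> ?P \<gamma>" using P p by (metis insert_iff)+
    then show ?thesis using p(5) by blast
  qed
  ultimately show "\<exists>B. finite B \<and> card B \<le> 2 \<and> (\<forall>\<gamma>. ?P \<gamma> \<noteq> {} \<and>
        (\<gamma> \<notin> B \<longrightarrow> (\<exists>p\<in>?P \<gamma>. \<exists>q\<in>?P \<gamma>. p \<noteq> q)))"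
    using B(1,2) by blast
qed simp

text \<open>The vertex \<open>y\<close> is four edges away from the center, hence the condition on
  its degree and the deep shape.\<close>

lemma shape_thread3:
  assumes u: "N u = {w, v}" "w \<noteq> v" and v: "N v = {u, z}" "u \<noteq> z" and z: "N z = {v, y}" "v \<noteq> y"
    and y: "4 \<le> card (N y)"
  shows "shape w u {u, v, z} True"
proof (rule shapeI)
  show uw: "u \<in> N w" using u(1) N_sym by auto
  have e: "{w, u} \<in> E" "{u, v} \<in> E" "{v, z} \<in> E" "{z, y} \<in> E"
    using N_eq_D[OF u(1)] N_eq_D[OF v(1)] N_eq_D[OF z(1)] z by (auto simp: insert_commute edge_iff intro: N_sym)
  have n: "nb_walk E [w, u, v, z, y]" using e u v z by auto
  show "{u, v, z} \<subseteq> V" using N_eq_subset[OF u(1)] N_eq_subset[OF v(1)] N_eq_subset[OF z(1)] by simp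
  show "\<exists>p. nb_walk E (w # u # p) \<and> last (u # p) = a \<and> length p \<le> 2" if a: "a \<in> {u, v, z}" for a
  proof -
    consider "a = u" | "a = v" | "a = z" using a by auto
    then show ?thesis
    proof cases
      case 1
      then show ?thesis using e by (intro exI[of _ "[]"]) simp
    next
      case 2
      then show ?thesis using n by (intro exI[of _ "[v]"]) simp
    next
      case 3
      then show ?thesis using n by (intro exI[of _ "[v, z]"]) simp
    qed
  qed
  show "\<exists>p. nb_walk E (w # u # p @ [y']) \<and> (length p \<le> 1 \<or> length p = 2 \<and> True \<and> 4 \<le> card (N y'))"
    if "a \<in> {u, v, z}" "y' \<in> N a" "y' \<notin> {u, v, z}" "y' \<noteq> w" for a y'
    using that u v z y n by (intro exI[of _ "[v, z]"]) auto
  show "a = a'" if "y' \<notin> {u, v, z}" "y' \<noteq> w" "a \<in> {u, v, z}" "a' \<in> {u, v, z}" "y' \<in> N a" "y' \<in> N a'" for y' a a'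
    using that u(1) v(1) z(1) by auto
qed (use u v z in \<open>auto simp: card_insert_if\<close>)

text \<open>With colors \<open>p\<close>, \<open>q\<close>, \<open>r\<close> at \<open>u\<close>,
  \<open>v\<close>, \<open>z\<close>, uniqueness at \<open>u\<close>, \<open>v\<close>,
  \<open>z\<close> requires that \<open>q\<close> is not \<open>\<gamma>\<close>, \<open>r\<close>
  is not \<open>p\<close>, and \<open>q\<close> is not the color of \<open>y\<close>. Thus
  \<open>\<gamma>\<close> restricts \<open>p\<close> and \<open>q\<close> but not \<open>r\<close>,
  and a single color can be harmful instead of two.\<close>

lemma branch_thread3:
  assumes u: "N u = {w, v}" "w \<noteq> v" and v: "N v = {u, z}" "u \<noteq> z" and z: "N z = {v, y}" "v \<noteq> y"
  shows "branch w u {u, v, z} (heavy_branch 1)"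
proof (rule heavy_branchI)
  fix S \<phi> C
  assume S: "forbids S C" "{u, v, z} \<subseteq> S" "w \<in> S"
    and loc: "\<forall>a\<in>{u, v, z}. N a \<inter> S \<subseteq> insert w {u, v, z}"
  have "nb_walk E [w, u, v, z, y]"
    using N_eq_D[OF u(1)] N_eq_D[OF v(1)] N_eq_D[OF z(1)] u v z
    by (auto simp: insert_commute edge_iff intro: N_sym)
  then have "distinct [w, u, v, z, y]" by (rule nb_walk_distinct) simp
  then have d: "w \<noteq> u" "w \<noteq> v" "w \<noteq> z" "w \<noteq> y" "u \<noteq> v" "u \<noteq> z" "u \<noteq> y" "v \<noteq> z" "v \<noteq> y" "z \<noteq> y"
    by auto
  have yS: "y \<notin> S" using loc z d by auto
  have y: "y \<in> N z" using z(1) by simp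
  note f = forbids_card[OF S(1) y yS]
  define A where "A = L z - insert (\<phi> y) (C y)"
  have A: "2 \<le> card A"
    unfolding A_def using f f(2)[of "\<phi> y"] z by (intro list_remaining[OF z(1), of 2]) auto
  define X where "X = L v - {\<phi> y}"
  have X: "3 \<le> card X" unfolding X_def using v by (intro list_remaining[OF v(1), of 2]) auto
  let ?P = "branch_colors S \<phi> C w u {u, v, z}"
  have P: "p \<in> ?P \<gamma>"
    if "p \<in> L u" "p \<noteq> \<gamma>" "q \<in> X" "q \<noteq> \<gamma>" "q \<noteq> p" "r \<in> A" "r \<noteq> q" "r \<noteq> p" for p q r \<gamma>
  proof -
    let ?\<psi> = "\<phi>(w := \<gamma>, u := p, v := q, z := r)"
    have "uniq ?\<psi> {w, v}" "uniq ?\<psi> {u, z}" "uniq ?\<psi> {v, y}"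
      using d that by (intro uniq_insert2; simp add: X_def)+
    then have "ok_at ?\<psi> S C u" "ok_at ?\<psi> S C v" "ok_at ?\<psi> S C z"
      unfolding ok_at_def using that d u v z S(2,3) yS by (auto simp: A_def X_def)
    then show ?thesis unfolding branch_colors_def using d S(2,3) by (auto intro!: exI[of _ ?\<psi>])
  qed
  have cu: "2 \<le> card (N u)" using u by simp
  have ne: "?P \<gamma> \<noteq> {}" for \<gamma>
  proof -
    obtain q where q: "q \<in> X" "q \<noteq> \<gamma>" using ex_remaining[of "{\<gamma>}" X] X by auto
    obtain r where r: "r \<in> A" "r \<noteq> q" using ex_remaining[of "{q}" A] A by auto
    obtain p where "p \<in> L u" "p \<notin> {\<gamma>, q, r}" using list_one[OF u(1) cu] by blast
    then show ?thesis using P[of p \<gamma> q r] q r by auto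
  qed
  have two: "\<exists>p\<in>?P \<gamma>. \<exists>p'\<in>?P \<gamma>. p \<noteq> p'"
    if q: "q \<in> X" "q \<noteq> \<gamma>" "2 \<le> card (A - {q})" for q \<gamma>
  proof -
    obtain p p' where p: "p \<in> L u" "p \<notin> {\<gamma>, q}" "p' \<in> L u" "p' \<notin> {\<gamma>, q}" "p \<noteq> p'"
      using list_two[OF u(1) cu] by blast
    have "\<exists>r\<in>A. r \<noteq> q \<and> r \<noteq> c" for c using ex_remaining[of "{c}" "A - {q}"] q(3) by auto
    then have "p \<in> ?P \<gamma>" "p' \<in> ?P \<gamma>" using P p q by (metis insert_iff)+
    then show ?thesis using p(5) by blast
  qed
  \<comment> \<open>A color of \<open>v\<close> that is missing at \<open>z\<close> works for every color of \<open>w\<close> but itself.\<close>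
  show "\<exists>B. finite B \<and> card B \<le> 1 \<and> (\<forall>\<gamma>. ?P \<gamma> \<noteq> {} \<and>
        (\<gamma> \<notin> B \<longrightarrow> (\<exists>p\<in>?P \<gamma>. \<exists>q\<in>?P \<gamma>. p \<noteq> q)))"
  proof (cases "X \<subseteq> A")
    case True
    have "finite A" using A card.infinite by fastforce
    then have "3 \<le> card A" using X card_mono[OF _ True] by linarith
    then have A2: "2 \<le> card (A - {q})" for q using diff_card_le_card_Diff[of "{q}" A] by simp
    have "\<exists>q\<in>X. q \<noteq> \<gamma>" for \<gamma> using ex_remaining[of "{\<gamma>}" X] X by auto
    then show ?thesis using ne two A2 by (intro exI[of _ "{}"]) (metis card.empty finite.emptyI zero_le)
  next
    case False
    then obtain q where q: "q \<in> X" "q \<notin> A" by auto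
    then have "2 \<le> card (A - {q})" using A by simp
    then show ?thesis using ne two q by (intro exI[of _ "{q}"]) auto
  qed
qed simp

lemma shape_fork:
  assumes u: "N u = {w, x1, x2}" "w \<noteq> x1" "w \<noteq> x2" "x1 \<noteq> x2"
    and x: "N x1 = {u, y1}" "u \<noteq> y1" "N x2 = {u, y2}" "u \<noteq> y2"
  shows "shape w u {u, x1, x2} deep"
proof (rule shapeI)
  show uw: "u \<in> N w" using u(1) N_sym by auto
  have e: "{w, u} \<in> E" "{u, x1} \<in> E" "{x1, y1} \<in> E" "{u, x2} \<in> E" "{x2, y2} \<in> E"
    using N_eq_D[OF u(1)] N_eq_D[OF x(1)] N_eq_D[OF x(3)] x by (auto simp: insert_commute edge_iff intro: N_sym)
  have n: "nb_walk E [w, u, x1, y1]" "nb_walk E [w, u, x2, y2]" using e u x by auto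
  have "nb_walk E [y1, x1, u, x2, y2]" using e u x by (auto simp: insert_commute)
  then have d: "distinct [y1, x1, u, x2, y2]" by (rule nb_walk_distinct) simp
  show "{u, x1, x2} \<subseteq> V" using N_eq_subset[OF u(1)] N_eq_subset[OF x(1)] N_eq_subset[OF x(3)] by simp
  show "\<exists>p. nb_walk E (w # u # p) \<and> last (u # p) = a \<and> length p \<le> 2" if a: "a \<in> {u, x1, x2}" for a
  proof -
    consider "a = u" | "a = x1" | "a = x2" using a by auto
    then show ?thesis
    proof cases
      case 1
      then show ?thesis using e by (intro exI[of _ "[]"]) simp
    next
      case 2
      then show ?thesis using n by (intro exI[of _ "[x1]"]) simp
    next
      case 3
      then show ?thesis using n by (intro exI[of _ "[x2]"]) simp
    qed
  qed
  show "\<exists>p. nb_walk E (w # u # p @ [y']) \<and> (length p \<le> 1 \<or> length p = 2 \<and> deep \<and> 4 \<le> card (N y'))"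
    if a: "a \<in> {u, x1, x2}" "y' \<in> N a" "y' \<notin> {u, x1, x2}" "y' \<noteq> w" for a y'
  proof -
    consider "a = x1" "y' = y1" | "a = x2" "y' = y2" using a u x by auto
    then show ?thesis
    proof cases
      case 1
      then show ?thesis using n by (intro exI[of _ "[x1]"]) simp
    next
      case 2
      then show ?thesis using n by (intro exI[of _ "[x2]"]) simp
    qed
  qed
  show "a = a'" if "y' \<notin> {u, x1, x2}" "y' \<noteq> w" "a \<in> {u, x1, x2}" "a' \<in> {u, x1, x2}"
    "y' \<in> N a" "y' \<in> N a'" for y' a a'
    using that u(1) x(1,3) d by auto
qed (use u x in \<open>auto simp: card_insert_if\<close>)

text \<open>The two arms need \<open>p\<close> to avoid the colors of \<open>y1\<close> and
  \<open>y2\<close>; together with \<open>\<gamma>\<close> this leaves two of five colors. Around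
  \<open>u\<close> it suffices that \<open>x1\<close> differs from \<open>w\<close>, so only the
  choice in \<open>A1\<close> depends on \<open>\<gamma>\<close>.\<close>

lemma branch_fork:
  assumes u: "N u = {w, x1, x2}" "w \<noteq> x1" "w \<noteq> x2" "x1 \<noteq> x2"
    and x: "N x1 = {u, y1}" "u \<noteq> y1" "N x2 = {u, y2}" "u \<noteq> y2"
  shows "branch w u {u, x1, x2} (heavy_branch 2)"
proof (rule heavy_branchI)
  fix S \<phi> C
  assume S: "forbids S C" "{u, x1, x2} \<subseteq> S" "w \<in> S"
    and loc: "\<forall>a\<in>{u, x1, x2}. N a \<inter> S \<subseteq> insert w {u, x1, x2}"
  have e: "{w, u} \<in> E" "{u, x1} \<in> E" "{x1, y1} \<in> E" "{u, x2} \<in> E" "{x2, y2} \<in> E"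
    using N_eq_D[OF u(1)] N_eq_D[OF x(1)] N_eq_D[OF x(3)] x by (auto simp: insert_commute edge_iff intro: N_sym)
  have n: "nb_walk E [w, u, x1, y1]" "nb_walk E [w, u, x2, y2]" using e u x by auto
  have n': "nb_walk E [y1, x1, u, x2, y2]" using e u x by (auto simp: insert_commute)
  have "distinct [w, u, x1, y1]" "distinct [w, u, x2, y2]" "distinct [y1, x1, u, x2, y2]"
    using n[THEN nb_walk_distinct] n'[THEN nb_walk_distinct] by simp_all
  then have d: "w \<noteq> u" "w \<noteq> x1" "w \<noteq> x2" "w \<noteq> y1" "w \<noteq> y2" "u \<noteq> x1" "u \<noteq> x2" "u \<noteq> y1" "u \<noteq> y2"
    "x1 \<noteq> x2" "x1 \<noteq> y1" "x1 \<noteq> y2" "x2 \<noteq> y1" "x2 \<noteq> y2" by auto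
  have yS: "y1 \<notin> S" "y2 \<notin> S" using loc x d by auto
  have y: "y1 \<in> N x1" "y2 \<in> N x2" using x by simp_all
  note f1 = forbids_card[OF S(1) y(1) yS(1)] and f2 = forbids_card[OF S(1) y(2) yS(2)]
  define A1 where "A1 = L x1 - insert (\<phi> y1) (C y1)"
  define A2 where "A2 = L x2 - insert (\<phi> y2) (C y2)"
  have A: "2 \<le> card A1" "2 \<le> card A2"
    unfolding A1_def A2_def using f1 f2 f1(2)[of "\<phi> y1"] f2(2)[of "\<phi> y2"] x
    by (intro list_remaining[OF x(1), of 2] list_remaining[OF x(3), of 2]; auto)+
  let ?P = "branch_colors S \<phi> C w u {u, x1, x2}"
  have P: "p \<in> ?P \<gamma>"
    if "p \<in> L u" "p \<notin> {\<gamma>, \<phi> y1, \<phi> y2}" "q \<in> A1" "q \<noteq> p" "q \<noteq> \<gamma>" for p q \<gamma>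
  proof -
    obtain r where r: "r \<in> A2" "r \<noteq> p" using ex_remaining[of "{p}" A2] A by auto
    let ?\<psi> = "\<phi>(w := \<gamma>, u := p, x1 := q, x2 := r)"
    have "uniq ?\<psi> {u, y1}" "uniq ?\<psi> {u, y2}"
      using d that by (intro uniq_insert2; simp)+
    moreover have "uniq ?\<psi> {w, x1, x2}" using d that by (intro uniq_insert3) simp
    ultimately have "ok_at ?\<psi> S C u" "ok_at ?\<psi> S C x1" "ok_at ?\<psi> S C x2"
      unfolding ok_at_def using that d u x S(2,3) yS r by (auto simp: A1_def A2_def)
    then show ?thesis unfolding branch_colors_def using d S(2,3) by (auto intro!: exI[of _ ?\<psi>])
  qed
  have L: "\<exists>p\<in>L u. \<exists>p'\<in>L u. p \<notin> {\<gamma>, \<phi> y1, \<phi> y2} \<and> p' \<notin> {\<gamma>, \<phi> y1, \<phi> y2} \<and> p \<noteq> p'" for \<gamma>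
  proof -
    have "card {\<gamma>, \<phi> y1, \<phi> y2} + 2 \<le> 3 + 2" using card_insert_le2(2)[of \<gamma> "\<phi> y1" "\<phi> y2"] by linarith
    then have "2 \<le> card (L u - {\<gamma>, \<phi> y1, \<phi> y2})" by (intro list_remaining[OF u(1), of 3]) (use u in auto)
    then show ?thesis unfolding card_ge_2_iff by blast
  qed
  obtain B where B: "finite B" "card B \<le> 2" "\<And>\<gamma>. \<gamma> \<notin> B \<Longrightarrow> 2 \<le> card (A1 - {\<gamma>})"
    using bad_colors[OF A(1)] by auto
  have "?P \<gamma> \<noteq> {}" for \<gamma>
  proof -
    obtain q where q: "q \<in> A1" "q \<noteq> \<gamma>" using ex_remaining[of "{\<gamma>}" A1] A by auto
    obtain p where "p \<in> L u" "p \<notin> {\<gamma>, \<phi> y1, \<phi> y2}" "q \<noteq> p" using L[of \<gamma>] by metis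
    then show ?thesis using P[of p \<gamma> q] q by auto
  qed
  moreover have "\<exists>p\<in>?P \<gamma>. \<exists>q\<in>?P \<gamma>. p \<noteq> q" if "\<gamma> \<notin> B" for \<gamma>
  proof -
    obtain p p' where p: "p \<in> L u" "p \<notin> {\<gamma>, \<phi> y1, \<phi> y2}" "p' \<in> L u" "p' \<notin> {\<gamma>, \<phi> y1, \<phi> y2}" "p \<noteq> p'"
      using L[of \<gamma>] by metis
    have "\<exists>q\<in>A1. q \<noteq> \<gamma> \<and> q \<noteq> c" for c
      using ex_remaining[of "{c}" "A1 - {\<gamma>}"] B(3)[OF that] by auto
    then have "p \<in> ?P \<gamma>" "p' \<in> ?P \<gamma>" using P p by metis+
    then show ?thesis using p(5) by blast
  qed
  ultimately show "\<exists>B. finite B \<and> card B \<le> 2 \<and> (\<forall>\<gamma>. ?P \<gamma> \<noteq> {} \<and>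
        (\<gamma> \<notin> B \<longrightarrow> (\<exists>p\<in>?P \<gamma>. \<exists>q\<in>?P \<gamma>. p \<noteq> q)))"
    using B(1,2) by blast
qed simp

lemma shape_claw:
  assumes u: "N u = {w, r}" "w \<noteq> r" and r: "N r = {u, x2, x3}" "u \<noteq> x2" "u \<noteq> x3" "x2 \<noteq> x3"
    and x: "N x2 = {r, y2}" "r \<noteq> y2" "N x3 = {r, y3}" "r \<noteq> y3"
    and y: "4 \<le> card (N y2)" "4 \<le> card (N y3)"
  shows "shape w u {u, r, x2, x3} True"
proof (rule shapeI)
  show uw: "u \<in> N w" using u(1) N_sym by auto
  have e: "{w, u} \<in> E" "{u, r} \<in> E" "{r, x2} \<in> E" "{x2, y2} \<in> E" "{r, x3} \<in> E" "{x3, y3} \<in> E"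
    using N_eq_D[OF u(1)] N_eq_D[OF r(1)] N_eq_D[OF x(1)] N_eq_D[OF x(3)] x
    by (auto simp: insert_commute edge_iff intro: N_sym)
  have n: "nb_walk E [w, u, r, x2, y2]" "nb_walk E [w, u, r, x3, y3]" using e u x r by auto
  have n': "nb_walk E [y2, x2, r, x3, y3]" using e u x r by (auto simp: insert_commute)
  have d: "distinct [w, u, r, x2, y2]" "distinct [w, u, r, x3, y3]" "distinct [y2, x2, r, x3, y3]"
    using n[THEN nb_walk_distinct] n'[THEN nb_walk_distinct] by simp_all
  show "{u, r, x2, x3} \<subseteq> V"
    using N_eq_subset[OF u(1)] N_eq_subset[OF r(1)] N_eq_subset[OF x(1)] N_eq_subset[OF x(3)] by simp
  show "\<exists>p. nb_walk E (w # u # p) \<and> last (u # p) = a \<and> length p \<le> 2" if a: "a \<in> {u, r, x2, x3}" for a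
  proof -
    consider "a = u" | "a = r" | "a = x2" | "a = x3" using a by auto
    then show ?thesis
    proof cases
      case 1
      then show ?thesis using e by (intro exI[of _ "[]"]) simp
    next
      case 2
      then show ?thesis using n by (intro exI[of _ "[r]"]) simp
    next
      case 3
      then show ?thesis using n by (intro exI[of _ "[r, x2]"]) simp
    next
      case 4
      then show ?thesis using n by (intro exI[of _ "[r, x3]"]) simp
    qed
  qed
  show "\<exists>p. nb_walk E (w # u # p @ [y']) \<and> (length p \<le> 1 \<or> length p = 2 \<and> True \<and> 4 \<le> card (N y'))"
    if a: "a \<in> {u, r, x2, x3}" "y' \<in> N a" "y' \<notin> {u, r, x2, x3}" "y' \<noteq> w" for a y'
  proof -
    consider "a = x2" "y' = y2" | "a = x3" "y' = y3" using a u x r by auto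
    then show ?thesis
    proof cases
      case 1
      then show ?thesis using n y by (intro exI[of _ "[r, x2]"]) simp
    next
      case 2
      then show ?thesis using n y by (intro exI[of _ "[r, x3]"]) simp
    qed
  qed
  show "a = a'" if "y' \<notin> {u, r, x2, x3}" "y' \<noteq> w" "a \<in> {u, r, x2, x3}" "a' \<in> {u, r, x2, x3}"
    "y' \<in> N a" "y' \<in> N a'" for y' a a'
    using that u(1) r(1) x(1,3) d by auto
qed (use u r x in \<open>auto simp: card_insert_if\<close>)

text \<open>The argument for a thread of length 3, with \<open>r\<close> and \<open>x2\<close> in
  the roles of \<open>v\<close> and \<open>z\<close>. The other arm \<open>x3\<close> only has to be
  colored properly: the color of \<open>r\<close> avoids that of \<open>y3\<close>, and
  \<open>x2\<close> already differs from \<open>u\<close> around \<open>r\<close>.\<close>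

lemma branch_claw:
  assumes u: "N u = {w, r}" "w \<noteq> r" and r: "N r = {u, x2, x3}" "u \<noteq> x2" "u \<noteq> x3" "x2 \<noteq> x3"
    and x: "N x2 = {r, y2}" "r \<noteq> y2" "N x3 = {r, y3}" "r \<noteq> y3"
  shows "branch w u {u, r, x2, x3} (heavy_branch 1)"
proof (rule heavy_branchI)
  fix S \<phi> C
  assume S: "forbids S C" "{u, r, x2, x3} \<subseteq> S" "w \<in> S"
    and loc: "\<forall>a\<in>{u, r, x2, x3}. N a \<inter> S \<subseteq> insert w {u, r, x2, x3}"
  have e: "{w, u} \<in> E" "{u, r} \<in> E" "{r, x2} \<in> E" "{x2, y2} \<in> E" "{r, x3} \<in> E" "{x3, y3} \<in> E"
    using N_eq_D[OF u(1)] N_eq_D[OF r(1)] N_eq_D[OF x(1)] N_eq_D[OF x(3)] x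
    by (auto simp: insert_commute edge_iff intro: N_sym)
  have n: "nb_walk E [w, u, r, x2, y2]" "nb_walk E [w, u, r, x3, y3]" using e u x r by auto
  have n': "nb_walk E [y2, x2, r, x3, y3]" using e u x r by (auto simp: insert_commute)
  have "distinct [w, u, r, x2, y2]" "distinct [w, u, r, x3, y3]" "distinct [y2, x2, r, x3, y3]"
    using n[THEN nb_walk_distinct] n'[THEN nb_walk_distinct] by simp_all
  then have d: "w \<noteq> u" "w \<noteq> r" "w \<noteq> x2" "w \<noteq> x3" "w \<noteq> y2" "w \<noteq> y3" "u \<noteq> r" "u \<noteq> x2" "u \<noteq> x3" "u \<noteq> y2"
    "u \<noteq> y3" "r \<noteq> x2" "r \<noteq> x3" "r \<noteq> y2" "r \<noteq> y3" "x2 \<noteq> x3" "x2 \<noteq> y2" "x2 \<noteq> y3" "x3 \<noteq> y2" "x3 \<noteq> y3"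
    by auto
  have yS: "y2 \<notin> S" "y3 \<notin> S" using loc x d by auto
  have y: "y2 \<in> N x2" "y3 \<in> N x3" using x by simp_all
  note f2 = forbids_card[OF S(1) y(1) yS(1)] and f3 = forbids_card[OF S(1) y(2) yS(2)]
  define A2 where "A2 = L x2 - insert (\<phi> y2) (C y2)"
  define A3 where "A3 = L x3 - insert (\<phi> y3) (C y3)"
  have A: "2 \<le> card A2" "2 \<le> card A3"
    unfolding A2_def A3_def using f2 f3 f2(2)[of "\<phi> y2"] f3(2)[of "\<phi> y3"] x
    by (intro list_remaining[OF x(1), of 2] list_remaining[OF x(3), of 2]; auto)+
  define R where "R = L r - {\<phi> y2, \<phi> y3}"
  have R: "3 \<le> card R"
  proof -
    have "card {\<phi> y2, \<phi> y3} + 3 \<le> 3 + 2" using card_insert_le2(1)[of "\<phi> y2" "\<phi> y3"] by linarith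
    then show ?thesis unfolding R_def by (intro list_remaining[OF r(1), of 3]) (use r in auto)
  qed
  let ?P = "branch_colors S \<phi> C w u {u, r, x2, x3}"
  have P: "p \<in> ?P \<gamma>"
    if "p \<in> L u" "p \<noteq> \<gamma>" "p \<noteq> q" "q \<in> R" "q \<noteq> \<gamma>" "s \<in> A2" "s \<noteq> q" "s \<noteq> p" for p q s \<gamma>
  proof -
    obtain t where t: "t \<in> A3" "t \<noteq> q" using ex_remaining[of "{q}" A3] A by auto
    let ?\<psi> = "\<phi>(w := \<gamma>, u := p, r := q, x2 := s, x3 := t)"
    have "uniq ?\<psi> {w, r}" "uniq ?\<psi> {r, y2}" "uniq ?\<psi> {r, y3}"
      using d that by (intro uniq_insert2; simp add: R_def)+
    moreover have "uniq ?\<psi> {u, x2, x3}" using d that by (intro uniq_insert3) simp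
    ultimately have "ok_at ?\<psi> S C u" "ok_at ?\<psi> S C r" "ok_at ?\<psi> S C x2" "ok_at ?\<psi> S C x3"
      unfolding ok_at_def using that d u r x S(2,3) yS t by (auto simp: A2_def A3_def R_def)
    then show ?thesis unfolding branch_colors_def using d S(2,3) by (auto intro!: exI[of _ ?\<psi>])
  qed
  have cu: "2 \<le> card (N u)" using u by simp
  have ne: "?P \<gamma> \<noteq> {}" for \<gamma>
  proof -
    obtain q where q: "q \<in> R" "q \<noteq> \<gamma>" using ex_remaining[of "{\<gamma>}" R] R by auto
    obtain s where s: "s \<in> A2" "s \<noteq> q" using ex_remaining[of "{q}" A2] A by auto
    obtain p where "p \<in> L u" "p \<notin> {\<gamma>, q, s}" using list_one[OF u(1) cu] by blast
    then show ?thesis using P[of p \<gamma> q s] q s by auto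
  qed
  have two: "\<exists>p\<in>?P \<gamma>. \<exists>p'\<in>?P \<gamma>. p \<noteq> p'"
    if q: "q \<in> R" "q \<noteq> \<gamma>" "2 \<le> card (A2 - {q})" for q \<gamma>
  proof -
    obtain p p' where p: "p \<in> L u" "p \<notin> {\<gamma>, q}" "p' \<in> L u" "p' \<notin> {\<gamma>, q}" "p \<noteq> p'"
      using list_two[OF u(1) cu] by blast
    have "\<exists>r\<in>A2. r \<noteq> q \<and> r \<noteq> c" for c using ex_remaining[of "{c}" "A2 - {q}"] q(3) by auto
    then have "p \<in> ?P \<gamma>" "p' \<in> ?P \<gamma>" using P p q by (metis insert_iff)+
    then show ?thesis using p(5) by blast
  qed
  show "\<exists>B. finite B \<and> card B \<le> 1 \<and> (\<forall>\<gamma>. ?P \<gamma> \<noteq> {} \<and>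
        (\<gamma> \<notin> B \<longrightarrow> (\<exists>p\<in>?P \<gamma>. \<exists>q\<in>?P \<gamma>. p \<noteq> q)))"
  proof (cases "R \<subseteq> A2")
    case True
    have "finite A2" using A(1) card.infinite by fastforce
    then have "3 \<le> card A2" using R card_mono[OF _ True] by linarith
    then have c: "2 \<le> card (A2 - {q})" for q using diff_card_le_card_Diff[of "{q}" A2] by simp
    have "\<exists>q\<in>R. q \<noteq> \<gamma>" for \<gamma> using ex_remaining[of "{\<gamma>}" R] R by auto
    then show ?thesis using ne two c by (intro exI[of _ "{}"]) (metis card.empty finite.emptyI zero_le)
  next
    case False
    then obtain q where q: "q \<in> R" "q \<notin> A2" by auto
    then have "2 \<le> card (A2 - {q})" using A by simp
    then show ?thesis using ne two q by (intro exI[of _ "{q}"]) auto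
  qed
qed simp

end

section \<open>Reducible configurations\<close>

text \<open>A branch of which only the number \<open>f\<close> of forbidden colors of the center and the number \<open>b\<close>
  of colors at which it is not flexible matter; \<open>t\<close> marks a branch that is never flexible.\<close>

definition bounded_branch :: "nat \<Rightarrow> nat \<Rightarrow> bool \<Rightarrow> 'c set \<Rightarrow> ('c \<Rightarrow> 'c set) \<Rightarrow> bool" where
  "bounded_branch f b t F P \<longleftrightarrow> card F \<le> f \<and> (\<forall>\<gamma>. \<gamma> \<notin> F \<longrightarrow> P \<gamma> \<noteq> {}) \<and>
     (t \<or> (\<exists>B. finite B \<and> card B \<le> b \<and>
        (\<forall>\<gamma>. \<gamma> \<notin> F \<longrightarrow> \<gamma> \<notin> B \<longrightarrow> (\<exists>p\<in>P \<gamma>. \<exists>q\<in>P \<gamma>. p \<noteq> q))))"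

lemma fixed_bounded: "fixed_branch k F P \<Longrightarrow> bounded_branch k b True F P"
  unfolding fixed_branch_def bounded_branch_def by auto

lemma heavy_bounded: "heavy_branch k F P \<Longrightarrow> k \<le> b \<Longrightarrow> bounded_branch f b False F P"
  unfolding heavy_branch_def bounded_branch_def by (metis card.empty le_trans zero_le)

lemma link_bounded:
  assumes "link_branch 2 F P"
  shows "bounded_branch 1 2 False F P"
proof -
  obtain A where A: "2 \<le> card A" "\<And>\<gamma>. \<gamma> \<notin> F \<Longrightarrow> A - {\<gamma>} \<subseteq> P \<gamma>" and F: "card F \<le> 1"
    using assms unfolding link_branch_def by blast
  obtain B where B: "finite B" "card B \<le> 2" "\<And>\<gamma>. \<gamma> \<notin> B \<Longrightarrow> 2 \<le> card (A - {\<gamma>})"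
    using bad_colors[OF A(1)] by blast
  have "P \<gamma> \<noteq> {}" if "\<gamma> \<notin> F" for \<gamma>
    using ex_remaining[of "{\<gamma>}" A] A that by fastforce
  moreover have "\<exists>p\<in>P \<gamma>. \<exists>q\<in>P \<gamma>. p \<noteq> q" if "\<gamma> \<notin> F" "\<gamma> \<notin> B" for \<gamma>
    using B(3)[OF that(2)] A(2)[OF that(1)] unfolding card_ge_2_iff by blast
  ultimately show ?thesis using F B(1,2) unfolding bounded_branch_def by blast
qed

lemma link3_bounded:
  assumes "link_branch 3 F P"
  shows "bounded_branch 1 0 False F P"
proof -
  obtain A where A: "3 \<le> card A" "\<And>\<gamma>. \<gamma> \<notin> F \<Longrightarrow> A - {\<gamma>} \<subseteq> P \<gamma>" and F: "card F \<le> 1"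
    using assms unfolding link_branch_def by blast
  have "\<exists>p\<in>P \<gamma>. \<exists>q\<in>P \<gamma>. p \<noteq> q" if "\<gamma> \<notin> F" for \<gamma>
    using ex_two_remaining[of "{\<gamma>}" A] A(1) A(2)[OF that] by auto
  then show ?thesis using F unfolding bounded_branch_def
    by (metis card.empty empty_iff finite.emptyI le_refl)
qed

context minimal_counterexample
begin

lemma branch_mono:
  assumes "branch w u D Q" "\<And>F P. finite F \<Longrightarrow> Q F P \<Longrightarrow> Q' F P"
  shows "branch w u D Q'"
  using assms unfolding branch_def by meson

text \<open>Reduces a configuration to arithmetic. The factor
  \<open>card (N w) + 2 - sum f (N w)\<close> bounds the admissible colors of the center from below,
  and \<open>ineq\<close> says that on average they make fewer than \<open>m\<close> branches
  outside \<open>T\<close> rigid.\<close>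

lemma no_center:
  assumes w: "w \<in> V" "N w \<noteq> {}" and s: "\<And>u. u \<in> N w \<Longrightarrow> shape w u (D u) (u \<in> K)"
    and K: "finite K" "card K \<le> 2"
    and br: "\<And>u. u \<in> N w \<Longrightarrow> branch w u (D u) (bounded_branch (f u) (b u) (u \<in> T))"
    and T: "T \<subseteq> N w" and m: "m + card T \<le> 4" "m + card T \<le> card (N w)"
    and ineq: "int (sum b (N w - T)) < int m * (int (card (N w)) + 2 - int (sum f (N w)))"
  shows False
proof -
  obtain F P where F: "\<forall>u\<in>N w. finite (F u) \<and> bounded_branch (f u) (b u) (u \<in> T) (F u) (P u)"
    and no: "\<not> (\<exists>\<gamma>\<in>L w. \<exists>p. (\<forall>u\<in>N w. \<gamma> \<notin> F u \<and> p u \<in> P u \<gamma>) \<and> (N w \<noteq> {} \<longrightarrow> uniq p (N w)))"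
    using center_extension[of w D K "\<lambda>u. bounded_branch (f u) (b u) (u \<in> T)"] w(1) s K br by blast
  have "\<exists>B. \<forall>u\<in>N w - T. finite (B u) \<and> card (B u) \<le> b u \<and>
      (\<forall>\<gamma>. \<gamma> \<notin> F u \<longrightarrow> \<gamma> \<notin> B u \<longrightarrow> (\<exists>p\<in>P u \<gamma>. \<exists>q\<in>P u \<gamma>. p \<noteq> q))"
    by (rule bchoice) (use F in \<open>auto simp: bounded_branch_def\<close>)
  then obtain B where B': "\<forall>u\<in>N w - T. finite (B u) \<and> card (B u) \<le> b u \<and>
      (\<forall>\<gamma>. \<gamma> \<notin> F u \<longrightarrow> \<gamma> \<notin> B u \<longrightarrow> (\<exists>p\<in>P u \<gamma>. \<exists>q\<in>P u \<gamma>. p \<noteq> q))"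
    by (elim exE)
  note B = bspec[OF B']
  have "\<exists>\<gamma>\<in>L w. \<exists>p. (\<forall>i\<in>N w. \<gamma> \<notin> F i \<and> p i \<in> P i \<gamma>) \<and> uniq p (N w)"
  proof (rule center_choice[where T = T and f = f and b = b and m = m and B = B])
    show "card (N w) + 2 \<le> card (L w)" "finite (L w)" using lists[OF w(1)] by simp_all
    show "finite (F i) \<and> card (F i) \<le> f i" if "i \<in> N w" for i
      using F that unfolding bounded_branch_def by blast
    show "P i \<gamma> \<noteq> {}" if "i \<in> N w" "\<gamma> \<notin> F i" for i \<gamma>
      using F that unfolding bounded_branch_def by blast
    show "finite (B i) \<and> card (B i) \<le> b i" if "i \<in> N w - T" for i
      using B[OF that] by simp
    show "\<exists>p\<in>P i \<gamma>. \<exists>q\<in>P i \<gamma>. p \<noteq> q" if "i \<in> N w - T" "\<gamma> \<notin> F i" "\<gamma> \<notin> B i" for i \<gamma>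
      using B[OF that(1)] that(2,3) by simp
  qed (use T m ineq in auto)
  then show False using no by blast
qed

lemma bounded_fixed:
  assumes "u \<in> N w"
  shows "branch w u {} (bounded_branch 2 b True)"
proof (rule branch_mono[OF branch_fixed[OF assms]])
  fix F :: "'c set" and P
  assume "fixed_branch (if card (N u) = 3 then 1 else 2) F P"
  then have "fixed_branch 2 F P" unfolding fixed_branch_def by (auto split: if_splits)
  then show "bounded_branch 2 b True F P" by (rule fixed_bounded)
qed

lemma branch_link2:
  assumes "N u = {w, y}" "w \<noteq> y"
  shows "branch w u {u} (link_branch 2)"
proof (rule branch_mono[OF branch_link[OF assms]])
  fix F :: "'c set" and P
  assume "link_branch (if card (N y) = 3 then 3 else 2) F P"
  then obtain A where A: "(if card (N y) = 3 then 3 else 2) \<le> card A" and F: "card F \<le> 1"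
    "\<forall>\<gamma>. \<gamma> \<notin> F \<longrightarrow> A - {\<gamma>} \<subseteq> P \<gamma>" unfolding link_branch_def by (elim conjE exE)
  have "2 \<le> card A" using A by (simp split: if_splits)
  then show "link_branch 2 F P" unfolding link_branch_def using F by (intro conjI exI[of _ A])
qed

lemma bounded_link:
  "N u = {w, y} \<Longrightarrow> w \<noteq> y \<Longrightarrow> branch w u {u} (bounded_branch 1 2 False)"
  by (rule branch_mono, rule branch_link2, assumption+, rule link_bounded)

lemma bounded_link3:
  "N u = {w, y} \<Longrightarrow> w \<noteq> y \<Longrightarrow> card (N y) = 3 \<Longrightarrow> branch w u {u} (bounded_branch 1 0 False)"
  by (rule branch_mono, rule branch_link, assumption+, rule link3_bounded) simp

lemma bounded_heavy:
  "branch w u D (heavy_branch k) \<Longrightarrow> k \<le> b \<Longrightarrow> branch w u D (bounded_branch f b False)"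
  by (rule branch_mono, assumption, rule heavy_bounded)

section \<open>Configurations around vertices of degree 2 and 3\<close>

lemma N_card2:
  assumes "card (N u) = 2" "w \<in> N u"
  obtains y where "N u = {w, y}" "w \<noteq> y"
proof -
  have "card (N u - {w}) = 1" using assms by simp
  then obtain y where "N u - {w} = {y}" by (auto simp: card_1_singleton_iff)
  then show ?thesis using that[of y] assms by auto
qed

lemma N_card3:
  assumes "card (N u) = 3" "w \<in> N u"
  obtains x y where "N u = {w, x, y}" "w \<noteq> x" "w \<noteq> y" "x \<noteq> y"
proof -
  have "card (N u - {w}) = 2" using assms by simp
  then obtain x y where "N u - {w} = {x, y}" "x \<noteq> y" by (auto simp: card_2_iff)
  then show ?thesis using that[of x y] assms by auto
qed

lemma degree_ge_2:
  assumes v: "v \<in> V"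
  shows "2 \<le> card (N v)"
proof (rule ccontr)
  assume "\<not> ?thesis"
  then have c: "card (N v) \<le> 1" by simp
  obtain F P where F: "\<forall>u\<in>N v. finite (F u) \<and> bounded_branch 2 0 True (F u) (P u)"
    and no: "\<not> (\<exists>\<gamma>\<in>L v. \<exists>p. (\<forall>u\<in>N v. \<gamma> \<notin> F u \<and> p u \<in> P u \<gamma>) \<and> (N v \<noteq> {} \<longrightarrow> uniq p (N v)))"
    using center_extension[of v "\<lambda>_. {}" "{}" "\<lambda>_. bounded_branch 2 0 True"] v shape_empty
      bounded_fixed by auto
  show False
  proof (cases "N v = {}")
    case True
    have "L v \<noteq> {}" using lists[OF v] by auto
    then show False using no True by auto
  next
    case False
    then obtain u where u: "N v = {u}" using c by (metis One_nat_def card_0_eq card_1_singletonE finite_N le_Suc_eq le_zero_eq)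
    have Fu: "finite (F u)" "card (F u) \<le> 2" "\<And>\<gamma>. \<gamma> \<notin> F u \<Longrightarrow> P u \<gamma> \<noteq> {}"
      using F u unfolding bounded_branch_def by auto
    \<comment> \<open>A single neighbor carries a unique color without any flexibility, so three
      colors against two forbidden ones suffice.\<close>
    have "card (F u) < card (L v)" using Fu(2) lists[OF v] u by simp
    then obtain \<gamma> where g: "\<gamma> \<in> L v" "\<gamma> \<notin> F u" using ex_remaining[OF Fu(1)] by blast
    then obtain c where "c \<in> P u \<gamma>" using Fu(3) by auto
    then show False using no g u
      by (auto simp: uniq_def dest!: bspec[of _ _ \<gamma>] spec[of _ "\<lambda>_. c"])
  qed
qed

text \<open>With \<open>m = card (N w) - 1\<close> the count of \<open>no_center\<close> ends in
  equality, so two admissible colors \<open>c1\<close> and \<open>c2\<close> are compared instead.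
  At \<open>c1\<close> the color \<open>x\<close> of \<open>u0\<close> is unique unless some link
  can only take \<open>x\<close>. The set \<open>A\<close> of that link then lies in
  \<open>{c1, x}\<close>, misses \<open>c2\<close>, and makes the link flexible at
  \<open>c2\<close>; the at most three other branches may be rigid.\<close>

lemma no_fixed_degree_3:
  assumes w: "w \<in> V" "card (N w) \<le> 4" and u0: "u0 \<in> N w" "card (N u0) = 3"
    and links: "\<And>u. u \<in> N w \<Longrightarrow> u \<noteq> u0 \<Longrightarrow> card (N u) = 2"
  shows False
proof -
  have ex: "\<exists>y. N u = {w, y} \<and> w \<noteq> y" if "u \<in> N w" "u \<noteq> u0" for u
    using N_card2[OF links[OF that] N_sym[OF that(1)]] by blast
  let ?D = "\<lambda>u. if u = u0 then {} else {u}"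
  let ?Q = "\<lambda>u. if u = u0 then fixed_branch 1 else link_branch 2"
  have sh: "shape w u (?D u) (u \<in> {})" if "u \<in> N w" for u
    using shape_empty shape_link ex[OF that] that by auto
  have br: "branch w u (?D u) (?Q u)" if "u \<in> N w" for u
    using branch_fixed[OF u0(1)] u0(2) branch_link2 ex[OF that] by auto
  have c0: "card {} \<le> 2" by simp
  have "\<exists>F P. (\<forall>u\<in>N w. finite (F u) \<and> ?Q u (F u) (P u)) \<and>
      \<not> (\<exists>\<gamma>\<in>L w. \<exists>p. (\<forall>u\<in>N w. \<gamma> \<notin> F u \<and> p u \<in> P u \<gamma>) \<and> (N w \<noteq> {} \<longrightarrow> uniq p (N w)))"
    by (rule center_extension[of w ?D "{}" ?Q])
      (rule w(1), rule sh, assumption, rule finite.emptyI, rule c0, rule br, assumption)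
  then obtain F P where F: "\<forall>u\<in>N w. finite (F u) \<and> ?Q u (F u) (P u)"
    and no: "\<not> (\<exists>\<gamma>\<in>L w. \<exists>p. (\<forall>u\<in>N w. \<gamma> \<notin> F u \<and> p u \<in> P u \<gamma>) \<and> (N w \<noteq> {} \<longrightarrow> uniq p (N w)))"
    by (elim exE conjE)
  have cF: "finite (F u) \<and> card (F u) \<le> 1" if "u \<in> N w" for u
    using bspec[OF F that] by (cases "u = u0") (simp_all add: fixed_branch_def link_branch_def)
  have "card (L w) \<le> card (L w - (\<Union>u\<in>N w. F u)) + sum (\<lambda>_. 1) (N w)"
    using cF lists[OF w(1)] by (intro card_Diff_UN_ge) auto
  then have "2 \<le> card (L w - (\<Union>u\<in>N w. F u))" using lists[OF w(1)] by simp
  then obtain c1 c2 where "c1 \<in> L w - (\<Union>u\<in>N w. F u)" "c2 \<in> L w - (\<Union>u\<in>N w. F u)" "c1 \<noteq> c2"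
    unfolding card_ge_2_iff by (elim conjE bexE)
  then have c: "c1 \<in> L w" "c2 \<in> L w" "c1 \<noteq> c2" "\<And>u. u \<in> N w \<Longrightarrow> c1 \<notin> F u \<and> c2 \<notin> F u"
    by simp_all
  obtain x where x: "x \<in> F u0" "\<And>\<gamma>. P u0 \<gamma> = {x}"
    using bspec[OF F u0(1)] by (auto simp: fixed_branch_def)
  have "\<exists>A. 2 \<le> card A \<and> (\<forall>\<gamma>. \<gamma> \<notin> F u \<longrightarrow> A - {\<gamma>} \<subseteq> P u \<gamma>)" if "u \<in> N w - {u0}" for u
    using bspec[OF F, of u] that by (simp add: link_branch_def)
  then obtain A where A: "\<And>u. u \<in> N w - {u0} \<Longrightarrow> 2 \<le> card (A u)"
    "\<And>u \<gamma>. u \<in> N w - {u0} \<Longrightarrow> \<gamma> \<notin> F u \<Longrightarrow> A u - {\<gamma>} \<subseteq> P u \<gamma>" by metis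
  show False
  proof (cases "\<forall>u\<in>N w - {u0}. \<exists>a\<in>P u c1. a \<noteq> x")
    case True
    then obtain p where p: "\<And>u. u \<in> N w - {u0} \<Longrightarrow> p u \<in> P u c1 \<and> p u \<noteq> x" by metis
    have "\<forall>u\<in>N w. c1 \<notin> F u \<and> (p(u0 := x)) u \<in> P u c1" using c(4) p x(2) by auto
    moreover have "uniq (p(u0 := x)) (N w)" unfolding uniq_def using u0(1) p by (intro bexI[of _ u0]) auto
    ultimately show False using no c(1) by blast
  next
    case False
    then obtain u where u: "u \<in> N w" "u \<noteq> u0" "P u c1 \<subseteq> {x}" by auto
    then have "A u \<subseteq> {c1, x}" using A(2)[of u c1] c(4)[OF u(1)] by auto
    then have "c2 \<notin> A u" using c(3,4) x(1) u0(1) by auto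
    then have "A u \<subseteq> P u c2" using A(2)[of u c2] c(4) u by auto
    then have flex: "\<exists>p\<in>P u c2. \<exists>q\<in>P u c2. p \<noteq> q" using A(1)[of u] u unfolding card_ge_2_iff by blast
    have "\<exists>p. (\<forall>i\<in>N w. p i \<in> P i c2) \<and> uniq p (N w)"
    proof (rule unique_selection[where J = "N w - {u}"])
      show "P i c2 \<noteq> {}" if "i \<in> N w" for i
      proof (cases "i = u0")
        case False
        then show ?thesis using ex_remaining[of "{c2}" "A i"] A[of i] c(4)[OF that] that by fastforce
      qed (use x(2) in simp)
      show "card (N w - {u}) \<le> 3" using w(2) u(1) by simp
    qed (use u flex in auto)
    then show False using no c(2,4) by blast
  qed
qed

lemma N_in_V: "x \<in> N y \<Longrightarrow> x \<in> V"
  using N_subset by blast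

lemma thread_end:
  assumes "card (N u) = 2" "card (N v) = 2" "v \<in> N u" "a \<in> N u" "a \<noteq> v"
  shows "card (N a) \<noteq> 3"
proof
  assume a: "card (N a) = 3"
  obtain a' where "N u = {v, a'}" using N_card2[OF assms(1,3)] by blast
  then have "N u = {v, a}" using assms(4,5) by auto
  moreover from this have "u \<in> V" by (rule N_eq_subset)
  ultimately show False using no_fixed_degree_3[of u a] a assms(1,2,5) by auto
qed

text \<open>The center is \<open>u2\<close>, with the link \<open>u1\<close> on one side and the
  thread of \<open>u3\<close> and \<open>u4\<close> on the other. Only the link forbids a color, and
  2 + 2 < 2 * (4 - 1).\<close>

lemma no_long_thread:
  assumes "N u1 = {u0, u2}" "u0 \<noteq> u2" "N u2 = {u1, u3}" "u1 \<noteq> u3" "N u3 = {u2, u4}" "u2 \<noteq> u4"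
    "N u4 = {u3, u5}" "u3 \<noteq> u5"
  shows False
proof (rule no_center[of u2 "\<lambda>u. if u = u1 then {u1} else {u3, u4}" "{}" "\<lambda>u. if u = u1 then 1 else 0"
      "\<lambda>u. 2" "{}" 2])
  have e: "N u1 = {u2, u0}" "u2 \<noteq> u0" using assms by auto
  show "shape u2 u (if u = u1 then {u1} else {u3, u4}) (u \<in> {})" if "u \<in> N u2" for u
    using that shape_link[OF e] shape_thread2[OF assms(5-8)] assms(3,4) by auto
  show "branch u2 u (if u = u1 then {u1} else {u3, u4}) (bounded_branch (if u = u1 then 1 else 0) 2 (u \<in> {}))"
    if "u \<in> N u2" for u
    using that bounded_link[OF e] bounded_heavy[OF branch_thread2[OF assms(5-8)], of 2 0]
      assms(3,4) by auto
  show "u2 \<in> V" using N_in_V[of u2 u1] assms by simp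
qed (use assms in auto)

lemma no_degree_3_neighbor:
  assumes "N v = {a, x1, x2}" "card (N x1) = 2" "card (N x2) = 2"
  shows "card (N a) \<noteq> 3"
proof
  assume a: "card (N a) = 3"
  have "v \<in> V" using N_eq_subset assms(1) by blast
  moreover have "card (N v) \<le> 4" using assms(1) by (simp add: card_insert_if)
  ultimately show False using no_fixed_degree_3[of v a] a assms by auto
qed

lemma claw_end:
  assumes r: "card (N r) = 3" "\<And>x. x \<in> N r \<Longrightarrow> card (N x) = 2" and x: "x \<in> N r" "y \<in> N x" "y \<noteq> r"
  shows "4 \<le> card (N y)"
proof -
  have "card (N y) \<noteq> 2" using thread_end[of x y r] r x N_sym by auto
  moreover have "card (N y) \<noteq> 3"
  proof
    assume y: "card (N y) = 3"
    obtain x2 x3 where n: "N r = {x, x2, x3}" "x \<noteq> x2" "x \<noteq> x3" "x2 \<noteq> x3" using N_card3[OF r(1) x(1)] by blast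
    have ex: "\<exists>z. N u = {r, z} \<and> r \<noteq> z" if "u \<in> N r" for u
      using N_card2[OF r(2)[OF that] N_sym[OF that]] by blast
    have xy: "N x = {r, y}" "r \<noteq> y" using ex[OF x(1)] x by auto
    show False
    \<comment> \<open>Since \<open>y\<close> has degree 3, the link \<open>x\<close> is never rigid
      and the count is 0 + 2 + 2 < 3 * 2; three ordinary links would give 6 against 6.\<close>
    proof (rule no_center[of r "\<lambda>u. {u}" "{}" "\<lambda>u. 1" "\<lambda>u. if u = x then 0 else 2" "{}" 3])
      show "branch r u {u} (bounded_branch 1 (if u = x then 0 else 2) (u \<in> {}))" if "u \<in> N r" for u
        using bounded_link3[OF xy y] bounded_link ex[OF that] by auto
      show "shape r u {u} (u \<in> {})" if "u \<in> N r" for u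
        using shape_link ex[OF that] by auto
      show "r \<in> V" using N_eq_subset n(1) by blast
    qed (use n r(1) in auto)
  qed
  ultimately show ?thesis using degree_ge_2[OF N_in_V[OF x(2)]] by linarith
qed

end

section \<open>Vertices of degree at least 4\<close>

context minimal_counterexample
begin

abbreviation "is2 x \<equiv> card (N x) = 2"

definition thread :: "'a \<Rightarrow> 'a \<Rightarrow> bool" where
  "thread w u \<longleftrightarrow> is2 u \<and> (\<exists>v\<in>N u. v \<noteq> w \<and> is2 v)"

definition long_thread :: "'a \<Rightarrow> 'a \<Rightarrow> bool" where
  "long_thread w u \<longleftrightarrow> is2 u \<and> (\<exists>v\<in>N u. v \<noteq> w \<and> is2 v \<and> (\<exists>z\<in>N v. z \<noteq> u \<and> is2 z))"

definition claw :: "'a \<Rightarrow> bool" where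
  "claw r \<longleftrightarrow> card (N r) = 3 \<and> (\<forall>x\<in>N r. is2 x)"

definition to_claw :: "'a \<Rightarrow> 'a \<Rightarrow> bool" where
  "to_claw w u \<longleftrightarrow> is2 u \<and> (\<exists>r\<in>N u. r \<noteq> w \<and> claw r)"

definition fork :: "'a \<Rightarrow> bool" where
  "fork u \<longleftrightarrow> card (N u) = 3 \<and> card {x \<in> N u. is2 x} = 2"

lemma long_thread_thread: "long_thread w u \<Longrightarrow> thread w u"
  unfolding long_thread_def thread_def by blast

text \<open>The amount, in ninths, that a vertex \<open>w\<close> of degree at least 4 sends to its neighbor \<open>u\<close>.\<close>

definition weight :: "'a \<Rightarrow> 'a \<Rightarrow> int" where
  "weight w u = (if long_thread w u then 9 else if thread w u then 6 else if to_claw w u then 5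
     else if is2 u then 3 else if fork u then 3 else 0)"

text \<open>Forgets which vertices are deleted. The flag \<open>k\<close> permits a deep branch, so
  only branches with \<open>k\<close> true count against the limit of two.\<close>

definition has_branch :: "'a \<Rightarrow> 'a \<Rightarrow> bool \<Rightarrow> nat \<Rightarrow> nat \<Rightarrow> bool \<Rightarrow> bool" where
  "has_branch w u k f b t \<longleftrightarrow> (\<exists>D. shape w u D k \<and> branch w u D (bounded_branch f b t))"

lemma has_fixed: "u \<in> N w \<Longrightarrow> has_branch w u k 2 b True"
  unfolding has_branch_def using shape_empty bounded_fixed by blast

lemma has_link:
  assumes "u \<in> N w" "is2 u"
  shows "has_branch w u k 1 2 False"
proof -
  obtain y where "N u = {w, y}" "w \<noteq> y" using N_card2[OF assms(2) N_sym[OF assms(1)]] .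
  then show ?thesis unfolding has_branch_def using shape_link bounded_link by blast
qed

lemma has_thread:
  assumes u: "u \<in> N w" "thread w u"
  shows "has_branch w u k 0 2 False"
proof -
  obtain v where v: "is2 u" "v \<in> N u" "v \<noteq> w" "is2 v" using u(2) unfolding thread_def by blast
  have nu: "N u = {w, v}" using N_card2[OF v(1) N_sym[OF u(1)]] v(2,3) by auto
  obtain y where nv: "N v = {u, y}" "u \<noteq> y" using N_card2[OF v(4) N_sym[OF v(2)]] .
  have "w \<noteq> v" using v(3) by simp
  then show ?thesis
    unfolding has_branch_def using shape_thread2[OF nu _ nv] bounded_heavy[OF branch_thread2[OF nu _ nv]] by blast
qed

lemma has_long_thread:
  assumes u: "u \<in> N w" "long_thread w u"
  shows "has_branch w u True 0 1 False"
proof -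
  obtain v z where v: "is2 u" "v \<in> N u" "v \<noteq> w" "is2 v" "z \<in> N v" "z \<noteq> u" "is2 z"
    using u(2) unfolding long_thread_def by blast
  have nu: "N u = {w, v}" "w \<noteq> v" using N_card2[OF v(1) N_sym[OF u(1)]] v(2,3) by auto
  have nv: "N v = {u, z}" "u \<noteq> z" using N_card2[OF v(4) N_sym[OF v(2)]] v(5,6) by auto
  obtain y where nz: "N z = {v, y}" "v \<noteq> y" using N_card2[OF v(7) N_sym[OF v(5)]] .
  have y: "y \<in> N z" using nz by simp
  have "card (N y) \<noteq> 3" using thread_end[OF v(7,4) N_sym[OF v(5)] y] nz by auto
  moreover have "card (N y) \<noteq> 2"
  proof
    assume "card (N y) = 2"
    then obtain y' where "N y = {z, y'}" "z \<noteq> y'" using N_card2 N_sym[OF y] by blast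
    then show False using no_long_thread[OF nu nv nz] by blast
  qed
  ultimately have "4 \<le> card (N y)" using degree_ge_2[OF N_in_V[OF y]] by linarith
  then have "shape w u {u, v, z} True" by (rule shape_thread3[OF nu nv nz])
  moreover have "branch w u {u, v, z} (bounded_branch 0 1 False)"
    by (rule bounded_heavy[OF branch_thread3[OF nu nv nz]]) simp
  ultimately show ?thesis unfolding has_branch_def by blast
qed

lemma has_to_claw:
  assumes u: "u \<in> N w" "to_claw w u"
  shows "has_branch w u True 0 2 False"
proof -
  obtain r where r: "is2 u" "r \<in> N u" "r \<noteq> w" "card (N r) = 3" "\<And>x. x \<in> N r \<Longrightarrow> is2 x"
    using u(2) unfolding to_claw_def claw_def by blast
  have nu: "N u = {w, r}" "w \<noteq> r" using N_card2[OF r(1) N_sym[OF u(1)]] r(2,3) by auto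
  obtain x2 x3 where nr: "N r = {u, x2, x3}" "u \<noteq> x2" "u \<noteq> x3" "x2 \<noteq> x3"
    using N_card3[OF r(4) N_sym[OF r(2)]] .
  have x: "x2 \<in> N r" "x3 \<in> N r" using nr by auto
  obtain y2 where n2: "N x2 = {r, y2}" "r \<noteq> y2" using N_card2[OF r(5)[OF x(1)] N_sym[OF x(1)]] .
  obtain y3 where n3: "N x3 = {r, y3}" "r \<noteq> y3" using N_card2[OF r(5)[OF x(2)] N_sym[OF x(2)]] .
  have "4 \<le> card (N y2)" using claw_end[OF r(4,5) x(1), of y2] n2 by auto
  moreover have "4 \<le> card (N y3)" using claw_end[OF r(4,5) x(2), of y3] n3 by auto
  ultimately have "shape w u {u, r, x2, x3} True" by (rule shape_claw[OF nu nr n2 n3])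
  moreover have "branch w u {u, r, x2, x3} (bounded_branch 0 2 False)"
    by (rule bounded_heavy[OF branch_claw[OF nu nr n2 n3]]) simp
  ultimately show ?thesis unfolding has_branch_def by blast
qed

lemma fork_neighbors:
  assumes u: "u \<in> N w" "fork u" "\<not> is2 w"
  obtains x y where "N u = {w, x, y}" "w \<noteq> x" "w \<noteq> y" "x \<noteq> y" "is2 x" "is2 y"
proof -
  have c: "card (N u) = 3" "card {x \<in> N u. is2 x} = 2" using u(2) unfolding fork_def by auto
  obtain x y where n: "N u = {w, x, y}" "w \<noteq> x" "w \<noteq> y" "x \<noteq> y" using N_card3[OF c(1) N_sym[OF u(1)]] .
  have "{x \<in> N u. is2 x} \<subseteq> {x, y}" using n u(3) by auto
  moreover have "card {x, y} = 2" using n by simp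
  ultimately have "{x \<in> N u. is2 x} = {x, y}" using c(2) by (intro card_subset_eq) auto
  then show ?thesis using that[OF n] by blast
qed

lemma has_fork:
  assumes u: "u \<in> N w" "fork u" "\<not> is2 w"
  shows "has_branch w u k 0 2 False"
proof -
  obtain x1 x2 where n: "N u = {w, x1, x2}" "w \<noteq> x1" "w \<noteq> x2" "x1 \<noteq> x2" and i: "is2 x1" "is2 x2"
    using fork_neighbors[OF u] .
  have x: "u \<in> N x1" "u \<in> N x2" using n N_sym by auto
  obtain y1 where n1: "N x1 = {u, y1}" "u \<noteq> y1" using N_card2[OF i(1) x(1)] .
  obtain y2 where n2: "N x2 = {u, y2}" "u \<noteq> y2" using N_card2[OF i(2) x(2)] .
  have "shape w u {u, x1, x2} k" by (rule shape_fork[OF n n1 n2])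
  moreover have "branch w u {u, x1, x2} (bounded_branch 0 2 False)"
    by (rule bounded_heavy[OF branch_fork[OF n n1 n2]]) simp
  ultimately show ?thesis unfolding has_branch_def by blast
qed

lemma sum_of_bool_card:
  assumes "finite I" "X \<subseteq> I"
  shows "(\<Sum>u\<in>I. of_bool (u \<in> X)) = int (card X)"
proof -
  have "(\<Sum>u\<in>I. of_bool (u \<in> X)) = int (card (I \<inter> X))" using assms(1) by (simp add: Int_def)
  then show ?thesis using assms(2) by (simp add: inf.absorb2)
qed

text \<open>The counting behind the reduction: \<open>a\<close> long threads, \<open>h\<close> short threads, \<open>b\<close> claws, \<open>c\<close> forks,
  \<open>s\<close> other neighbors of degree 2 and \<open>t\<close> further neighbors; \<open>k\<close> long threads and \<open>l\<close> claws
  are deleted completely.\<close>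

lemma center_arith:
  fixes a h b c s t k l d :: int
  assumes "0 \<le> a" "0 \<le> h" "0 \<le> b" "0 \<le> c" "0 \<le> s" "0 \<le> t"
    and d: "d = a + h + b + c + s + t" "4 \<le> d" and w: "9 * a + 6 * h + 5 * b + 3 * c + 3 * s > 9 * d - 24"
    and k: "k = min a 1" and l: "l = (if a = 0 then min b 2 else min b 1)"
  shows "t \<le> 2" "2 * (d - t) - k < (4 - t) * (d + 2 - (2 * t + s + b - l))"
proof -
  \<comment> \<open>What each neighbor's weight lacks to 9, summed over the neighborhood. A neighbor
    that receives nothing lacks 9, so there are at most two of these.\<close>
  have q: "3 * h + 4 * b + 6 * c + 6 * s + 9 * t < 24" using w d(1) by linarith
  then show t2: "t \<le> 2" using assms(1-6) by linarith
  consider "t = 0" | "t = 1" | "t = 2" using t2 assms(6) by linarith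
  then show "2 * (d - t) - k < (4 - t) * (d + 2 - (2 * t + s + b - l))"
  proof cases
    case 1
    show ?thesis unfolding 1 using q 1 assms(1-6) d k l by (auto simp: min_def split: if_splits)
  next
    case 2
    show ?thesis unfolding 2 using q 2 assms(1-6) d k l by (auto simp: min_def split: if_splits)
  next
    case 3
    have sc: "s = 0" "c = 0" "h + b \<le> 1" using q 3 assms(1-6) by arith+
    show ?thesis unfolding 3 sc(1,2) using sc q 3 assms(1-6) d k l by (auto simp: min_def split: if_splits)
  qed
qed

lemma weight_bound:
  assumes w: "w \<in> V" "4 \<le> card (N w)"
  shows "(\<Sum>u\<in>N w. weight w u) \<le> 9 * int (card (N w)) - 24"
proof (rule ccontr)
  assume "\<not> ?thesis"
  then have big: "9 * int (card (N w)) - 24 < (\<Sum>u\<in>N w. weight w u)" by simp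
  define A where "A = {u \<in> N w. long_thread w u}"
  define H where "H = {u \<in> N w. thread w u \<and> \<not> long_thread w u}"
  define B where "B = {u \<in> N w. to_claw w u \<and> \<not> thread w u}"
  define S where "S = {u \<in> N w. is2 u \<and> \<not> thread w u \<and> \<not> to_claw w u}"
  define C where "C = {u \<in> N w. \<not> is2 u \<and> fork u}"
  define T where "T = {u \<in> N w. \<not> is2 u \<and> \<not> fork u}"
  note defs = A_def H_def B_def S_def C_def T_def
  have sub: "A \<subseteq> N w" "H \<subseteq> N w" "B \<subseteq> N w" "S \<subseteq> N w" "C \<subseteq> N w" "T \<subseteq> N w"
    unfolding defs by auto
  have is2: "thread w u \<Longrightarrow> is2 u" "to_claw w u \<Longrightarrow> is2 u" for u
    unfolding thread_def to_claw_def by auto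
  note lt = long_thread_thread
  \<comment> \<open>The deep branches, at most two in all. A long thread in \<open>K\<close> saves
    one rigid color over a short one, a claw in \<open>M\<close> saves one forbidden color over a
    link. The other long threads are treated as short ones, the other claws as links.\<close>
  obtain K where K: "K \<subseteq> A" "card K = min (card A) 1" "finite K"
    using obtain_subset_with_card_n[of "min (card A) 1" A] by auto
  obtain M where M: "M \<subseteq> B" "card M = (if card A = 0 then min (card B) 2 else min (card B) 1)" "finite M"
    by (rule obtain_subset_with_card_n[of "if card A = 0 then min (card B) 2 else min (card B) 1" B]) simp_all
  define f :: "'a \<Rightarrow> nat" where "f u = (if u \<in> T then 2 else if u \<in> S \<or> u \<in> B - M then 1 else 0)" for u
  define b :: "'a \<Rightarrow> nat" where "b u = (if u \<in> K then 1 else 2)" for u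
  have has: "has_branch w u (u \<in> K \<union> M) (f u) (b u) (u \<in> T)" if u: "u \<in> N w" for u
  proof -
    consider "u \<in> A" "u \<in> K" | "u \<in> A" "u \<notin> K" | "u \<in> H" | "u \<in> B" "u \<in> M" | "u \<in> B" "u \<notin> M"
      | "u \<in> S" | "u \<in> C" | "u \<in> T"
      using u unfolding defs by blast
    then show ?thesis
    proof cases
      case 1
      then have "u \<notin> T" "u \<notin> S" "u \<notin> B" using lt is2 unfolding defs by blast+
      then show ?thesis using has_long_thread[OF u] 1 unfolding f_def b_def A_def by simp
    next
      case 2
      then have "u \<notin> T" "u \<notin> S" "u \<notin> B" using lt is2 unfolding defs by blast+
      then show ?thesis using has_thread[OF u lt] 2 unfolding f_def b_def A_def by simp
    next
      case 3
      then have "u \<notin> T" "u \<notin> S" "u \<notin> B" "u \<notin> K" using K(1) lt is2 unfolding defs by blast+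
      then show ?thesis using has_thread[OF u] 3 unfolding f_def b_def H_def by simp
    next
      case 4
      then have "u \<notin> T" "u \<notin> S" "u \<notin> K" using K(1) lt is2 unfolding defs by blast+
      then show ?thesis using has_to_claw[OF u] 4 unfolding f_def b_def B_def by simp
    next
      case 5
      then have "u \<notin> T" "u \<notin> K" "is2 u" using K(1) lt is2 unfolding defs by blast+
      then show ?thesis using has_link[OF u] 5 unfolding f_def b_def by simp
    next
      case 6
      then have "u \<notin> T" "u \<notin> K" "u \<notin> M" "is2 u" using K(1) M(1) lt is2 unfolding defs by blast+
      then show ?thesis using has_link[OF u] 6 unfolding f_def b_def by simp
    next
      case 7
      then have "u \<notin> T" "u \<notin> S" "u \<notin> B" "u \<notin> K" using K(1) lt is2 unfolding defs by blast+
      then show ?thesis using has_fork[OF u] 7 w(2) unfolding f_def b_def C_def by simp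
    next
      case 8
      then have "u \<notin> K" "u \<notin> M" using K(1) M(1) lt is2 unfolding defs by blast+
      then show ?thesis using has_fixed[OF u] 8 unfolding f_def b_def by simp
    qed
  qed
  define cA where "cA = int (card A)"
  define cH where "cH = int (card H)"
  define cB where "cB = int (card B)"
  define cS where "cS = int (card S)"
  define cC where "cC = int (card C)"
  define cT where "cT = int (card T)"
  define cK where "cK = int (card K)"
  define cM where "cM = int (card M)"
  define d where "d = int (card (N w))"
  note cdefs = cA_def cH_def cB_def cS_def cC_def cT_def cK_def cM_def d_def
  note ob = sum_of_bool_card[OF finite_N, of _ w]
  have d: "d = cA + cH + cB + cC + cS + cT"
  proof -
    have "d = (\<Sum>u\<in>N w. 1)" unfolding d_def by simp
    also have "\<dots> = (\<Sum>u\<in>N w. of_bool (u \<in> A) + of_bool (u \<in> H) + of_bool (u \<in> B) + of_bool (u \<in> C)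
        + of_bool (u \<in> S) + of_bool (u \<in> T))"
      by (intro sum.cong refl) (auto simp: defs dest: lt is2)
    finally show ?thesis unfolding cdefs using sub by (simp add: sum.distrib ob del: sum_of_bool_eq)
  qed
  have wt: "(\<Sum>u\<in>N w. weight w u) = 9 * cA + 6 * cH + 5 * cB + 3 * cC + 3 * cS"
  proof -
    have "(\<Sum>u\<in>N w. weight w u) = (\<Sum>u\<in>N w. 9 * of_bool (u \<in> A) + 6 * of_bool (u \<in> H) + 5 * of_bool (u \<in> B)
        + 3 * of_bool (u \<in> C) + 3 * of_bool (u \<in> S))"
      by (intro sum.cong refl) (auto simp: defs weight_def dest: lt is2)
    then show ?thesis unfolding cdefs using sub
      by (simp add: sum.distrib ob sum_distrib_left[symmetric] del: sum_of_bool_eq)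
  qed
  have sf: "int (sum f (N w)) = 2 * cT + cS + cB - cM"
  proof -
    have "int (sum f (N w)) = (\<Sum>u\<in>N w. int (f u))" by simp
    also have "\<dots> = (\<Sum>u\<in>N w. 2 * of_bool (u \<in> T) + of_bool (u \<in> S) + of_bool (u \<in> B) - of_bool (u \<in> M))"
      using M(1) by (intro sum.cong refl) (auto simp: f_def defs dest: lt is2)
    finally show ?thesis unfolding cdefs using sub M(1)
      by (simp add: sum.distrib sum_subtractf ob sum_distrib_left[symmetric] del: sum_of_bool_eq)
  qed
  have sb: "int (sum b (N w - T)) = 2 * (d - cT) - cK"
  proof -
    have KT: "K \<subseteq> N w - T" using K(1) lt is2 unfolding defs by blast
    have "int (sum b (N w - T)) = (\<Sum>u\<in>N w - T. int (b u))" by simp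
    also have "\<dots> = (\<Sum>u\<in>N w - T. 2 - of_bool (u \<in> K))" by (intro sum.cong refl) (simp add: b_def)
    also have "\<dots> = 2 * int (card (N w - T)) - int (card K)"
      using sum_of_bool_card[OF _ KT] by (simp add: sum_subtractf del: sum_of_bool_eq)
    also have "int (card (N w - T)) = d - cT"
      unfolding d_def cT_def using sub(6) by (simp add: card_Diff_subset finite_subset[OF _ finite_N] card_mono of_nat_diff)
    finally show ?thesis unfolding cK_def .
  qed
  have nn: "0 \<le> cA" "0 \<le> cH" "0 \<le> cB" "0 \<le> cC" "0 \<le> cS" "0 \<le> cT" unfolding cdefs by simp_all
  have d4: "4 \<le> d" using w(2) unfolding d_def by simp
  have big': "9 * cA + 6 * cH + 5 * cB + 3 * cC + 3 * cS > 9 * d - 24" using big wt unfolding d_def by simp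
  have cK: "cK = min cA 1" unfolding cK_def cA_def K(2) by (simp add: min_def)
  have cM: "cM = (if cA = 0 then min cB 2 else min cB 1)" unfolding cM_def cA_def cB_def M(2) by (simp add: min_def)
  note arith = center_arith[OF nn d d4 big' cK cM]
  have T2: "card T \<le> 2" using arith(1) unfolding cT_def by simp
  have KM: "finite (K \<union> M)" "card (K \<union> M) \<le> 2"
  proof -
    show "finite (K \<union> M)" using K M by simp
    have "card (K \<union> M) \<le> card K + card M" by (rule card_Un_le)
    also have "\<dots> \<le> 2" using K(2) M(2) by (simp split: if_splits)
    finally show "card (K \<union> M) \<le> 2" .
  qed
  from has have "\<forall>u\<in>N w. \<exists>D. shape w u D (u \<in> K \<union> M) \<and> branch w u D (bounded_branch (f u) (b u) (u \<in> T))"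
    unfolding has_branch_def by blast
  then have "\<exists>D. \<forall>u\<in>N w. shape w u (D u) (u \<in> K \<union> M) \<and> branch w u (D u) (bounded_branch (f u) (b u) (u \<in> T))"
    by (rule bchoice)
  then obtain D where D: "\<forall>u\<in>N w. shape w u (D u) (u \<in> K \<union> M) \<and> branch w u (D u) (bounded_branch (f u) (b u) (u \<in> T))"
    by (elim exE)
  show False
  proof (rule no_center[of w D "K \<union> M" f b T "4 - card T"])
    show "N w \<noteq> {}" using w(2) by auto
    show "shape w u (D u) (u \<in> K \<union> M)" if "u \<in> N w" for u using bspec[OF D that] by (elim conjE)
    show "branch w u (D u) (bounded_branch (f u) (b u) (u \<in> T))" if "u \<in> N w" for u
      using bspec[OF D that] by (elim conjE)
    have "int (4 - card T) = 4 - cT" using T2 unfolding cT_def by simp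
    then show "int (sum b (N w - T)) < int (4 - card T) * (int (card (N w)) + 2 - int (sum f (N w)))"
      unfolding sb sf d_def[symmetric] using arith(2) by simp
  qed (use w KM sub(6) T2 in simp_all)
qed

end

section \<open>Discharging\<close>

context minimal_counterexample
begin

text \<open>The charge that passes from \<open>a\<close> to its neighbor \<open>b\<close>: a vertex of degree 2 hands on what its
  neighbor of degree at least 4 sends to the middle of a thread of length 3 or to a claw.\<close>

definition flow :: "'a \<Rightarrow> 'a \<Rightarrow> int" where
  "flow a b = (if 4 \<le> card (N a) then weight a b
     else if card (N a) = 3 then (if is2 b then 3 else 0)
     else if is2 b \<and> (\<forall>x\<in>N b. is2 x) then 3 else if claw b then 2 else 0)"

lemma flow_nonneg: "0 \<le> flow a b"
  unfolding flow_def weight_def by simp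

text \<open>Each end pays half of the 6 that \<open>x\<close> needs, and also what \<open>x\<close>
  hands on to the opposite end. Behind an arm of a claw the payer has degree at least 4, so its
  weight 5 covers both.\<close>

lemma flow_through:
  assumes x: "N x = {a, b}" "a \<noteq> b" and n: "\<not> is2 a" "\<not> is2 b"
  shows "3 + flow x b \<le> flow a x"
proof -
  have ax: "a \<in> N x" "b \<in> N x" using x by auto
  have x2: "is2 x" using x by simp
  have fx: "flow x b = (if claw b then 2 else 0)" unfolding flow_def using x2 n by simp
  have a: "3 \<le> card (N a)" using degree_ge_2[OF N_in_V[OF ax(1)]] n(1) by linarith
  show ?thesis
  proof (cases "claw b")
    case True
    then have "4 \<le> card (N a)" using claw_end[of b x a] x N_sym[OF ax(2)] unfolding claw_def by auto
    moreover have "to_claw a x" using True x x2 unfolding to_claw_def by auto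
    ultimately show ?thesis using fx True unfolding flow_def weight_def by simp
  next
    case False
    then show ?thesis using a fx x2 unfolding flow_def weight_def by simp
  qed
qed

text \<open>The end \<open>a\<close> alone pays for \<open>x\<close>, and 3 more if \<open>x\<close>
  has to supply the middle of a thread of length 3. Nothing flows back, as \<open>a\<close> has
  degree at least 4.\<close>

lemma flow_thread:
  assumes x: "N x = {a, b}" "a \<noteq> b" and n: "\<not> is2 a" "is2 b"
  shows "6 + flow x b + flow x a \<le> flow a x"
proof -
  have ax: "a \<in> N x" "b \<in> N x" using x by auto
  have x2: "is2 x" using x by simp
  have "card (N a) \<noteq> 3" using thread_end[OF x2 n(2) ax(2,1) x(2)] .
  then have a: "4 \<le> card (N a)" using degree_ge_2[OF N_in_V[OF ax(1)]] n(1) by linarith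
  have t: "thread a x" using x x2 n unfolding thread_def by auto
  have fa: "flow x a = 0" using x2 n(1) a unfolding flow_def claw_def by simp
  show ?thesis
  proof (cases "\<forall>z\<in>N b. is2 z")
    case True
    obtain z where z: "N b = {x, z}" "x \<noteq> z" using N_card2[OF n(2) N_sym[OF ax(2)]] .
    then have "long_thread a x" using True x x2 n unfolding long_thread_def by auto
    then show ?thesis using fa a True x2 n unfolding flow_def weight_def by simp
  next
    case False
    then have "flow x b = 0" using x2 n unfolding flow_def claw_def by simp
    then show ?thesis using fa a t unfolding flow_def weight_def by simp
  qed
qed

text \<open>The middle does not pay in turn: its neighbor \<open>a\<close> would have to be a middle
  as well, giving four consecutive vertices of degree 2.\<close>

lemma flow_middle:
  assumes x: "N x = {a, b}" "a \<noteq> b" and n: "is2 a" "is2 b"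
  shows "flow a x = 3" "flow x a = 0"
proof -
  have ax: "a \<in> N x" "b \<in> N x" using x by auto
  have x2: "is2 x" using x by simp
  show "flow a x = 3" using x x2 n unfolding flow_def by simp
  obtain a' where a: "N a = {x, a'}" "x \<noteq> a'" using N_card2[OF n(1) N_sym[OF ax(1)]] .
  obtain b' where b: "N b = {x, b'}" "x \<noteq> b'" using N_card2[OF n(2) N_sym[OF ax(2)]] .
  have aa: "a' \<in> N a" using a by simp
  have "\<not> is2 a'"
  proof
    assume "is2 a'"
    then obtain a0 where a0: "N a' = {a, a0}" "a \<noteq> a0" using N_card2[OF _ N_sym[OF aa]] by blast
    have sw: "N a' = {a0, a}" "N a = {a', x}" "a0 \<noteq> a" "a' \<noteq> x" using a0 a by auto
    show False using no_long_thread[OF sw(1,3,2,4) x b] .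
  qed
  then show "flow x a = 0" using x2 n a unfolding flow_def claw_def by simp
qed

text \<open>The balance at degree 3 is exact in the two critical cases: 3 - 6 + 3 for a fork, whose
  third neighbor has degree at least 4, and 3 - 9 + 3 * 2 for a claw.\<close>

lemma final_charge:
  assumes v: "v \<in> V"
  shows "0 \<le> 9 * int (card (N v)) - 24 + (\<Sum>u\<in>N v. flow u v) - (\<Sum>u\<in>N v. flow v u)"
proof -
  have in0: "0 \<le> (\<Sum>u\<in>N v. flow u v)" using flow_nonneg by (intro sum_nonneg)
  consider "is2 v" | "card (N v) = 3" | "4 \<le> card (N v)" using degree_ge_2[OF v] by linarith
  then show ?thesis
  proof cases
    case 1
    then obtain a b where n: "N v = {a, b}" "a \<noteq> b" by (auto simp: card_2_iff)
    then have n': "N v = {b, a}" "b \<noteq> a" by auto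
    have "6 + flow v a + flow v b \<le> flow a v + flow b v"
    proof (cases "is2 a"; cases "is2 b")
      assume "is2 a" "is2 b"
      then show ?thesis using flow_middle[OF n] flow_middle[OF n'] by simp
    next
      assume "is2 a" "\<not> is2 b"
      then show ?thesis using flow_thread[OF n'] flow_nonneg[of a v] by linarith
    next
      assume "\<not> is2 a" "is2 b"
      then show ?thesis using flow_thread[OF n] flow_nonneg[of b v] by linarith
    next
      assume "\<not> is2 a" "\<not> is2 b"
      then show ?thesis using flow_through[OF n] flow_through[OF n'] by linarith
    qed
    then show ?thesis using n by simp
  next
    case 2
    let ?k = "card {x \<in> N v. is2 x}"
    have "(\<Sum>u\<in>N v. flow v u) = (\<Sum>u\<in>N v. if is2 u then 3 else 0)" using 2 unfolding flow_def by simp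
    also have "\<dots> = 3 * int ?k" by (simp add: sum.If_cases Int_def)
    finally have out: "(\<Sum>u\<in>N v. flow v u) = 3 * int ?k" .
    have "?k \<le> 3" unfolding 2[symmetric] by (intro card_mono) auto
    then consider "?k \<le> 1" | "?k = 2" | "?k = 3" by linarith
    then show ?thesis
    proof cases
      case 1
      then show ?thesis using out in0 2 by simp
    next
      case two: 2
      have "{x \<in> N v. is2 x} \<noteq> N v" using two 2 by auto
      then obtain w where w: "w \<in> N v" "\<not> is2 w" by blast
      have f: "fork v" using two 2 unfolding fork_def by simp
      obtain x y where n: "N v = {w, x, y}" "w \<noteq> x" "w \<noteq> y" "x \<noteq> y" "is2 x" "is2 y"
        using fork_neighbors[OF N_sym[OF w(1)] f w(2)] .
      have "card (N w) \<noteq> 3" using no_degree_3_neighbor[OF n(1,5,6)] .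
      then have "4 \<le> card (N w)" using degree_ge_2[OF N_in_V[OF w(1)]] w(2) by linarith
      then have "flow w v = 3" using 2 f unfolding flow_def weight_def long_thread_def thread_def to_claw_def by simp
      then have "3 \<le> (\<Sum>u\<in>N v. flow u v)" using n flow_nonneg[of x v] flow_nonneg[of y v] by simp
      then show ?thesis using out two 2 by simp
    next
      case 3
      then have "{x \<in> N v. is2 x} = N v" using 2 by (intro card_subset_eq) auto
      then have all: "\<forall>x\<in>N v. is2 x" by blast
      then have "claw v" using 2 unfolding claw_def by simp
      then have "flow u v = 2" if "u \<in> N v" for u using all that 2 unfolding flow_def by simp
      then show ?thesis using out 2 3 by simp
    qed
  next
    case 3
    then have "(\<Sum>u\<in>N v. flow v u) = (\<Sum>u\<in>N v. weight v u)" unfolding flow_def by simp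
    then show ?thesis using weight_bound[OF v 3] in0 by linarith
  qed
qed

text \<open>Summed over all vertices, incoming and outgoing flow cancel and only the initial charges
  remain.\<close>

lemma many_edges: "8 * card V \<le> 3 * (\<Sum>v\<in>V. card (N v))"
proof -
  have finV: "finite V" using graph unfolding fin_simple_graph_def by simp
  have "(\<Sum>v\<in>V. \<Sum>u\<in>{u \<in> V. u \<in> N v}. flow u v) = (\<Sum>v\<in>V. \<Sum>u\<in>{u \<in> V. v \<in> N u}. flow v u)"
    by (rule sum.swap_restrict[OF finV finV])
  moreover have "{u \<in> V. u \<in> N v} = N v" "{u \<in> V. v \<in> N u} = N v" for v
    using N_in_V N_sym by blast+
  ultimately have swap: "(\<Sum>v\<in>V. \<Sum>u\<in>N v. flow u v) = (\<Sum>v\<in>V. \<Sum>u\<in>N v. flow v u)" by simp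
  have "0 \<le> (\<Sum>v\<in>V. 9 * int (card (N v)) - 24 + (\<Sum>u\<in>N v. flow u v) - (\<Sum>u\<in>N v. flow v u))"
    using final_charge by (intro sum_nonneg)
  also have "\<dots> = 9 * (\<Sum>v\<in>V. int (card (N v))) - 24 * int (card V)"
    using swap by (simp add: sum.distrib sum_subtractf sum_distrib_left)
  finally have "24 * int (card V) \<le> 9 * int (\<Sum>v\<in>V. card (N v))" by simp
  then show ?thesis by linarith
qed

end

section \<open>Edge counting, the induction on the number of vertices, and the theorem\<close>

lemma handshake:
  assumes g: "fin_simple_graph V E"
  shows "(\<Sum>v\<in>V. card (neighborhood E v)) = 2 * card E"
proof -
  have finV: "finite V" and E: "\<And>e. e \<in> E \<Longrightarrow> e \<subseteq> V \<and> card e = 2"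
    using g unfolding fin_simple_graph_def by auto
  have finE: "finite E" by (rule finite_subset[of _ "Pow V"]) (use E finV in auto)
  have "card (neighborhood E v) = card {e \<in> E. v \<in> e}" for v
  proof (rule bij_betw_same_card)
    show "bij_betw (\<lambda>u. {u, v}) (neighborhood E v) {e \<in> E. v \<in> e}"
    proof (rule bij_betwI')
      show "({x, v} = {y, v}) = (x = y)" for x y by (auto simp: doubleton_eq_iff)
      show "{x, v} \<in> {e \<in> E. v \<in> e}" if "x \<in> neighborhood E v" for x
        using that unfolding neighborhood_def by simp
      show "\<exists>x\<in>neighborhood E v. e = {x, v}" if "e \<in> {e \<in> E. v \<in> e}" for e
      proof -
        obtain x y where "e = {x, y}" using E[of e] \<open>e \<in> {e \<in> E. v \<in> e}\<close> by (auto simp: card_2_iff)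
        then have "e = {x, v} \<or> e = {y, v}" using that by auto
        then show ?thesis using that unfolding neighborhood_def by auto
      qed
    qed
  qed
  then have "(\<Sum>v\<in>V. card (neighborhood E v)) = (\<Sum>v\<in>V. card {e \<in> E. v \<in> e})" by simp
  also have "\<dots> = (\<Sum>v\<in>V. \<Sum>e\<in>{e \<in> E. v \<in> e}. 1)" by simp
  also have "\<dots> = (\<Sum>e\<in>E. \<Sum>v\<in>{v \<in> V. v \<in> e}. 1)" by (rule sum.swap_restrict[OF finV finE])
  also have "\<dots> = (\<Sum>e\<in>E. 2)"
  proof (rule sum.cong[OF refl])
    fix e assume "e \<in> E"
    then have "{v \<in> V. v \<in> e} = e" "card e = 2" using E by blast+
    then show "(\<Sum>v\<in>{v \<in> V. v \<in> e}. 1) = (2::nat)" by simp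
  qed
  finally show ?thesis by simp
qed

text \<open>All assumptions survive the deletion of vertices, with the same \<open>L\<close>,
  because degrees only drop. A smallest counterexample would satisfy
  \<open>8 * card V \<le> 6 * card E\<close>, against the third assumption for the graph
  itself.\<close>

lemma sparse_list_coloring:
  assumes "fin_simple_graph V E" and "\<And>p. is_cycle E p \<Longrightarrow> 7 \<le> length p"
    and "\<And>V' E'. subgraph V' E' V E \<Longrightarrow> V' \<noteq> {} \<Longrightarrow> 6 * card E' < 8 * card V'"
    and "\<And>v. v \<in> V \<Longrightarrow> finite (L v) \<and> card (neighborhood E v) + 2 \<le> card (L v)"
  shows "\<exists>\<phi>. \<forall>v\<in>V. \<phi> v \<in> L v \<and> (\<forall>u\<in>neighborhood E v. \<phi> u \<noteq> \<phi> v) \<and>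
    (neighborhood E v \<noteq> {} \<longrightarrow> uniq \<phi> (neighborhood E v))"
  using assms
proof (induction "card V" arbitrary: V E rule: less_induct)
  case less
  show ?case
  proof (rule ccontr)
    assume no: "\<not> ?thesis"
    have finV: "finite V" using less.prems(1) unfolding fin_simple_graph_def by simp
    have "minimal_counterexample V E L"
    proof unfold_locales
      fix S
      assume S: "S \<subseteq> V" "S \<noteq> {}"
      let ?E = "{e \<in> E. e \<inter> S = {}}"
      have "card (V - S) < card V" using S finV by (intro psubset_card_mono) auto
      moreover have "fin_simple_graph (V - S) ?E"
        using less.prems(1) unfolding fin_simple_graph_def by auto
      moreover have "7 \<le> length p" if "is_cycle ?E p" for p
        using less.prems(2)[of p] that unfolding is_cycle_def by auto
      moreover have "6 * card E' < 8 * card V'" if "subgraph V' E' (V - S) ?E" "V' \<noteq> {}" for V' E'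
        using less.prems(3)[of V' E'] that unfolding subgraph_def by auto
      moreover have nb: "neighborhood ?E v = neighborhood E v - S" if "v \<in> V - S" for v
        using that unfolding neighborhood_def by auto
      moreover have "finite (L v) \<and> card (neighborhood ?E v) + 2 \<le> card (L v)" if v: "v \<in> V - S" for v
      proof -
        have "card (neighborhood E v - S) \<le> card (neighborhood E v)"
          using finite_neighborhood[OF less.prems(1)] by (intro card_mono) auto
        moreover have "finite (L v) \<and> card (neighborhood E v) + 2 \<le> card (L v)" using less.prems(4) v by blast
        ultimately show ?thesis using nb[OF v] by simp
      qed
      ultimately have "\<exists>\<phi>. \<forall>v\<in>V - S. \<phi> v \<in> L v \<and> (\<forall>u\<in>neighborhood ?E v. \<phi> u \<noteq> \<phi> v) \<and>
          (neighborhood ?E v \<noteq> {} \<longrightarrow> uniq \<phi> (neighborhood ?E v))"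
        by (intro less.hyps)
      then show "\<exists>\<phi>. \<forall>v\<in>V - S. \<phi> v \<in> L v \<and> (\<forall>u\<in>neighborhood E v - S. \<phi> u \<noteq> \<phi> v) \<and>
          (neighborhood E v - S \<noteq> {} \<longrightarrow> uniq \<phi> (neighborhood E v - S))"
        using nb by simp
    qed (use less.prems no in blast)+
    then have "8 * card V \<le> 3 * (2 * card E)"
      using minimal_counterexample.many_edges handshake[OF less.prems(1)] by metis
    moreover have "V \<noteq> {}" using no by auto
    moreover have "subgraph V E V E" using less.prems(1) unfolding subgraph_def by simp
    ultimately show False using less.prems(3)[of V E] by linarith
  qed
qed

theorem theorem1p2:
  fixes V :: "'a set" and E :: "'a set set"
  assumes "fin_simple_graph V E"
    and "girth E \<ge> 7"
    and "mad V E < 8 / 3"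
  shows "pcf_degree_plus_choosable TYPE('c) 2 V E"
  unfolding pcf_degree_plus_choosable_def
proof (intro allI impI)
  fix L :: "'a \<Rightarrow> 'c set"
  assume L: "\<forall>v\<in>V. infinite (L v) \<or> card (L v) \<ge> degree E v + 2"
  \<comment> \<open>Infinite lists are cut down to finite ones of sufficient size, since the
    counting arguments rely on \<open>card\<close>.\<close>
  have "\<exists>M. M \<subseteq> L v \<and> finite M \<and> card (neighborhood E v) + 2 \<le> card M" if "v \<in> V" for v
  proof (cases "finite (L v)")
    case True
    then show ?thesis using L that unfolding degree_def by auto
  next
    case False
    then obtain M where "finite M" "card M = card (neighborhood E v) + 2" "M \<subseteq> L v"
      using infinite_arbitrarily_large by blast
    then show ?thesis by auto
  qed
  then obtain M where M: "\<And>v. v \<in> V \<Longrightarrow> M v \<subseteq> L v \<and> finite (M v) \<and> card (neighborhood E v) + 2 \<le> card (M v)"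
    by metis
  have cycles: "7 \<le> length p" if "is_cycle E p" for p
  proof -
    have "girth E \<le> enat (length p)" unfolding girth_def using that by (intro Inf_lower) auto
    then have "7 \<le> enat (length p)" using assms(2) by (rule order_trans[rotated])
    then show ?thesis by (simp add: numeral_eq_enat)
  qed
  have sparse: "6 * card E' < 8 * card V'" if sub: "subgraph V' E' V E" "V' \<noteq> {}" for V' E'
  proof -
    have V: "V \<noteq> {}" and fin: "finite V'" using sub unfolding subgraph_def fin_simple_graph_def by auto
    have "2 * real (card E') / real (card V') \<le> mad V E"
      unfolding mad_def using V sub mad_set_finite_nonempty(1)[OF assms(1) V]
      by (auto intro!: Max_ge)
    then have "2 * real (card E') / real (card V') < 8 / 3" using assms(3) by linarith
    moreover have "0 < real (card V')" using fin sub(2) by (simp add: card_gt_0_iff)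
    ultimately have "6 * real (card E') < 8 * real (card V')" by (simp add: field_simps)
    then show ?thesis by linarith
  qed
  obtain \<phi> where phi: "\<forall>v\<in>V. \<phi> v \<in> M v \<and> (\<forall>u\<in>neighborhood E v. \<phi> u \<noteq> \<phi> v) \<and>
      (neighborhood E v \<noteq> {} \<longrightarrow> uniq \<phi> (neighborhood E v))"
    using sparse_list_coloring[OF assms(1) cycles sparse, of M] M by blast
  have "proper_coloring E \<phi>"
    unfolding proper_coloring_def
  proof (intro allI impI)
    fix u v assume uv: "{u, v} \<in> E"
    then have "v \<in> V" using assms(1) unfolding fin_simple_graph_def by auto
    then show "\<phi> u \<noteq> \<phi> v" using phi uv unfolding neighborhood_def by blast
  qed
  then have "pcf_coloring V E \<phi>" using phi unfolding pcf_coloring_def uniq_iff by blast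
  moreover have "\<forall>v\<in>V. \<phi> v \<in> L v" using phi M by blast
  ultimately show "\<exists>\<phi>. pcf_coloring V E \<phi> \<and> (\<forall>v\<in>V. \<phi> v \<in> L v)" by blast
qed

end
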